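(* Let $\mathcal{C}$ be a closed symmetric monoidal category and let $\mathcal{T}$ be a one-object category enriched over $\mathcal{C}$, with hom-object $T$, composition $\mu:T\otimes T\to T$ and unit $\iota:1_{\mathcal{C}}\to T$. Let $\mathbb{F}_{\mathrm{enrich}}(\mathcal{T};\mathcal{C})$, $[\mathrm{Endo}(\mathcal{C})]_{\mathrm{para}}$ and $[\text{Left-action}(\mathcal{C})]$ be the collections of enriched semigroup actions, of parameterized endomorphisms and of left actions, respectively, as defined in the context. Then: (i) The objects and morphisms of $\mathbb{F}_{\mathrm{enrich}}(\mathcal{T};\mathcal{C})$, and those of $[\text{Left-action}(\mathcal{C})]$, form categories. (ii) These two categories are isomorphic. (iii) There is a bijective correspondence between the objects of these categories and the objects of $[\mathrm{Endo}(\mathcal{C})]_{\mathrm{para}}$. (iv) The three collections form three isomorphic categories, $\mathbb{F}_{\mathrm{enrich}}(\mathcal{T};\mathcal{C})\xrightarrow{\cong}[\mathrm{Endo}(\mathcal{C})]_{\mathrm{para}}\xrightarrow{\cong}[\text{Left-action}(\mathcal{C})]$, the composite being the isomorphism $\mathbb{F}_{\mathrm{enrich}}(\mathcal{T};\mathcal{C})\xrightarrow{\cong}[\text{Left-action}(\mathcal{C})]$. (v) The correspondence between an enriched functor $\tilde\Phi$ and its parametric form $\Phi^\sharp:T\to[\Omega;\Omega]$, and the correspondence between $\Phi^\sharp$ and its adjoint $\Phi:T\otimes\Omega\to\Omega$, are functorial.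
   Context: Time: the time semigroup $\mathcal{T}$ (with identity) is viewed as a one-object category enriched over $\mathcal{C}$; $(T,\mu,\iota)$ is then a monoid object in $\mathcal{C}$. Associators are suppressed; $\lambda,\rho$ denote left and right unitors. Internal homs: $[y;z]$ is the internal hom, with $\mathrm{Hom}(y\otimes x;z)\cong\mathrm{Hom}(x;[y;z])$; $\circ:[b;c]\otimes[a;b]\to[a;c]$ is the internal composition, adjoint to iterated evaluation; $\mathrm{Endo}(\Omega)=[\Omega;\Omega]$; $\iota_\Omega:1_{\mathcal{C}}\to[\Omega;\Omega]$ is the internal identity. $\mathcal{C}$ is enriched over itself via internal homs. For $h:\Omega\to\Omega'$, $h^\sharp:1_{\mathcal{C}}\to[\Omega;\Omega']$ is the corresponding morphism under adjunction. Enriched semigroup actions $\mathbb{F}_{\mathrm{enrich}}(\mathcal{T};\mathcal{C})$: objects are enriched functors $\tilde\Phi:\mathcal{T}\to\mathcal{C}$. Such a functor has a domain $\Omega\in\mathcal{C}$ (the image of the unique object) and an induced morphism $\Phi^\sharp:T\to\mathrm{Endo}(\Omega)$ (its parametric form) with $$(\ast)\qquad \Phi^\sharp\circ\iota=\iota_\Omega,\qquad \Phi^\sharp\circ\mu=\circ\,(\Phi^\sharp\otimes\Phi^\sharp).$$ Morphisms $\tilde\Phi\to\tilde\Phi'$ (domains $\Omega,\Omega'$) are enriched natural transformations, i.e. morphisms $h^\sharp:1_{\mathcal{C}}\to[\Omega;\Omega']$, equivalently $h:\Omega\to\Omega'$, such that the composites $T\xrightarrow{\rho_T^{-1}}T\otimes1_{\mathcal{C}}\xrightarrow{\Phi'^\sharp\otimes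 h^\sharp}\mathrm{Endo}(\Omega')\otimes[\Omega;\Omega']\xrightarrow{\circ}[\Omega;\Omega']$ and $T\xrightarrow{\lambda_T^{-1}}1_{\mathcal{C}}\otimes T\xrightarrow{h^\sharp\otimes\Phi^\sharp}[\Omega;\Omega']\otimes\mathrm{Endo}(\Omega)\xrightarrow{\circ}[\Omega;\Omega']$ are equal. The composite of $h$ and $h'$ is $1_{\mathcal{C}}\cong1_{\mathcal{C}}\otimes1_{\mathcal{C}}\xrightarrow{h'^\sharp\otimes h^\sharp}[\Omega';\Omega'']\otimes[\Omega;\Omega']\xrightarrow{\circ}[\Omega;\Omega'']$. Left actions $[\text{Left-action}(\mathcal{C})]$: objects are pairs $(\Omega,\Psi)$ with $\Psi:T\otimes\Omega\to\Omega$ such that $\Psi\circ(\iota\otimes\Omega)$ is the canonical isomorphism $1_{\mathcal{C}}\otimes\Omega\cong\Omega$ and $\Psi\circ(T\otimes\Psi)=\Psi\circ(\mu\otimes\Omega)$. Morphisms $(\Omega,\Psi)\to(\Omega',\Psi')$ are morphisms $h:\Omega\to\Omega'$ with $h\circ\Psi=\Psi'\circ(T\otimes h)$; composition is that of $\mathcal{C}$. Parameterized endomorphisms $[\mathrm{Endo}(\mathcal{C})]_{\mathrm{para}}$: objects are pairs of an object $\Omega$ and a morphism $\Psi^\sharp:T\to\mathrm{Endo}(\Omega)$ satisfying $(\ast)$. Its morphisms and their composition are defined by transport from $[\text{Left-action}(\mathcal{C})]$: a morphism $\Psi^\sharp\to\Psi'^\sharp$ is a morphism between the adjoints $\Psi:T\otimes\Omega\to\Omega$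 and $\Psi':T\otimes\Omega'\to\Omega'$ in $[\text{Left-action}(\mathcal{C})]$. *)

theory Defs
  imports "HOL-Library.FuncSet"
begin

record ('o, 'a) cat =
  Ob :: "'o set"
  Arr :: "'a set"
  Dom :: "'a \<Rightarrow> 'o"
  Cod :: "'a \<Rightarrow> 'o"
  Idm :: "'o \<Rightarrow> 'a"  (\<open>\<one>\<index>\<close>)
  Cmp :: "'a \<Rightarrow> 'a \<Rightarrow> 'a"  (infixr \<open>\<cdot>\<index>\<close> 70)

definition Hom :: "('o, 'a, 'm) cat_scheme \<Rightarrow> 'o \<Rightarrow> 'o \<Rightarrow> 'a set" where
  "Hom C a b = {f \<in> Arr C. Dom C f = a \<and> Cod C f = b}"

locale category =
  fixes C :: "('o, 'a, 'm) cat_scheme" (structure)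
  assumes dom_Ob: "f \<in> Arr C \<Longrightarrow> Dom C f \<in> Ob C"
    and cod_Ob: "f \<in> Arr C \<Longrightarrow> Cod C f \<in> Ob C"
    and id_Hom: "a \<in> Ob C \<Longrightarrow> \<one> a \<in> Hom C a a"
    and comp_Hom: "\<lbrakk>f \<in> Hom C a b; g \<in> Hom C b c\<rbrakk> \<Longrightarrow> g \<cdot> f \<in> Hom C a c"
    and comp_id_right: "f \<in> Hom C a b \<Longrightarrow> f \<cdot> \<one> a = f"
    and comp_id_left: "f \<in> Hom C a b \<Longrightarrow> \<one> b \<cdot> f = f"
    and comp_assoc: "\<lbrakk>f \<in> Hom C a b; g \<in> Hom C b c; h \<in> Hom C c d\<rbrakk>
        \<Longrightarrow> (h \<cdot> g) \<cdot> f = h \<cdot> (g \<cdot> f)"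

definition inverse_arrows :: "('o, 'a, 'm) cat_scheme \<Rightarrow> 'a \<Rightarrow> 'a \<Rightarrow> bool" where
  "inverse_arrows C f g \<longleftrightarrow>
     f \<in> Arr C \<and> g \<in> Hom C (Cod C f) (Dom C f) \<and>
     g \<cdot>\<^bsub>C\<^esub> f = \<one>\<^bsub>C\<^esub> (Dom C f) \<and> f \<cdot>\<^bsub>C\<^esub> g = \<one>\<^bsub>C\<^esub> (Cod C f)"

definition iso_arrow :: "('o, 'a, 'm) cat_scheme \<Rightarrow> 'a \<Rightarrow> bool" where
  "iso_arrow C f \<longleftrightarrow> (\<exists>g. inverse_arrows C f g)"

definition inv_arrow :: "('o, 'a, 'm) cat_scheme \<Rightarrow> 'a \<Rightarrow> 'a" where
  "inv_arrow C f = (THE g. inverse_arrows C f g)"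

record ('o, 'a, 'p, 'b) cfun =
  FOb :: "'o \<Rightarrow> 'p"
  FArr :: "'a \<Rightarrow> 'b"

definition cat_functor ::
  "('o, 'a, 'm) cat_scheme \<Rightarrow> ('p, 'b, 'n) cat_scheme \<Rightarrow> ('o, 'a, 'p, 'b) cfun \<Rightarrow> bool" where
  "cat_functor C D F \<longleftrightarrow>
     category C \<and> category D \<and>
     (\<forall>a \<in> Ob C. FOb F a \<in> Ob D) \<and>
     (\<forall>a \<in> Ob C. \<forall>b \<in> Ob C. \<forall>f \<in> Hom C a b. FArr F f \<in> Hom D (FOb F a) (FOb F b)) \<and>
     (\<forall>a \<in> Ob C. FArr F (\<one>\<^bsub>C\<^esub> a) = \<one>\<^bsub>D\<^esub> (FOb F a)) \<and>
     (\<forall>a \<in> Ob C. \<forall>b \<in> Ob C. \<forall>c \<in> Ob C. \<forall>f \<in> Hom C a b. \<forall>g \<in> Hom C b c.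
        FArr F (g \<cdot>\<^bsub>C\<^esub> f) = FArr F g \<cdot>\<^bsub>D\<^esub> FArr F f)"

definition id_functor :: "('o, 'a, 'o, 'a) cfun" where
  "id_functor = \<lparr>FOb = (\<lambda>a. a), FArr = (\<lambda>f. f)\<rparr>"

definition comp_functor ::
  "('p, 'b, 'q, 'c) cfun \<Rightarrow> ('o, 'a, 'p, 'b) cfun \<Rightarrow> ('o, 'a, 'q, 'c) cfun" where
  "comp_functor G F = \<lparr>FOb = FOb G \<circ> FOb F, FArr = FArr G \<circ> FArr F\<rparr>"

text \<open>The fields of a functor are total functions on types, so two functors with source \<open>C\<close> are
  compared only on the objects and arrows of \<open>C\<close>.\<close>

definition functor_eq_on ::
  "('o, 'a, 'm) cat_scheme \<Rightarrow> ('o, 'a, 'p, 'b) cfun \<Rightarrow> ('o, 'a, 'p, 'b) cfun \<Rightarrow> bool" where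
  "functor_eq_on C F G \<longleftrightarrow>
     (\<forall>a \<in> Ob C. FOb F a = FOb G a) \<and> (\<forall>f \<in> Arr C. FArr F f = FArr G f)"

definition inverse_functors ::
  "('o, 'a, 'm) cat_scheme \<Rightarrow> ('p, 'b, 'n) cat_scheme \<Rightarrow>
   ('o, 'a, 'p, 'b) cfun \<Rightarrow> ('p, 'b, 'o, 'a) cfun \<Rightarrow> bool" where
  "inverse_functors C D F G \<longleftrightarrow>
     cat_functor C D F \<and> cat_functor D C G \<and>
     functor_eq_on C (comp_functor G F) id_functor \<and>
     functor_eq_on D (comp_functor F G) id_functor"

definition cat_isomorphism ::
  "('o, 'a, 'm) cat_scheme \<Rightarrow> ('p, 'b, 'n) cat_scheme \<Rightarrow> ('o, 'a, 'p, 'b) cfun \<Rightarrow> bool" where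
  "cat_isomorphism C D F \<longleftrightarrow> (\<exists>G. inverse_functors C D F G)"


text \<open>The associator \<open>Asc C a b c\<close> goes from \<open>(a \<otimes> b) \<otimes> c\<close> to \<open>a \<otimes> (b \<otimes> c)\<close>, and \<open>Sym C a b\<close>
  from \<open>a \<otimes> b\<close> to \<open>b \<otimes> a\<close>.\<close>

record ('o, 'a) smcat = "('o, 'a) cat" +
  TOb :: "'o \<Rightarrow> 'o \<Rightarrow> 'o"  (infixr \<open>\<otimes>\<index>\<close> 75)
  TArr :: "'a \<Rightarrow> 'a \<Rightarrow> 'a"  (infixr \<open>\<boxtimes>\<index>\<close> 75)
  Unit :: "'o"  (\<open>\<I>\<index>\<close>)
  Asc :: "'o \<Rightarrow> 'o \<Rightarrow> 'o \<Rightarrow> 'a"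
  Lun :: "'o \<Rightarrow> 'a"
  Run :: "'o \<Rightarrow> 'a"
  Sym :: "'o \<Rightarrow> 'o \<Rightarrow> 'a"

locale symmetric_monoidal_category = category C
  for C :: "('o, 'a, 'm) smcat_scheme" (structure) +
  assumes tensor_Ob: "\<lbrakk>a \<in> Ob C; b \<in> Ob C\<rbrakk> \<Longrightarrow> a \<otimes> b \<in> Ob C"
    and unit_Ob: "\<I> \<in> Ob C"
    and tensor_Hom: "\<lbrakk>f \<in> Hom C a b; g \<in> Hom C c d\<rbrakk>
        \<Longrightarrow> f \<boxtimes> g \<in> Hom C (a \<otimes> c) (b \<otimes> d)"
    and tensor_id: "\<lbrakk>a \<in> Ob C; b \<in> Ob C\<rbrakk> \<Longrightarrow> \<one> a \<boxtimes> \<one> b = \<one> (a \<otimes> b)"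
    and interchange: "\<lbrakk>f \<in> Hom C a b; g \<in> Hom C b c; f' \<in> Hom C a' b'; g' \<in> Hom C b' c'\<rbrakk>
        \<Longrightarrow> (g \<cdot> f) \<boxtimes> (g' \<cdot> f') = (g \<boxtimes> g') \<cdot> (f \<boxtimes> f')"
    and assoc_Hom: "\<lbrakk>a \<in> Ob C; b \<in> Ob C; c \<in> Ob C\<rbrakk>
        \<Longrightarrow> Asc C a b c \<in> Hom C ((a \<otimes> b) \<otimes> c) (a \<otimes> (b \<otimes> c))"
    and assoc_iso: "\<lbrakk>a \<in> Ob C; b \<in> Ob C; c \<in> Ob C\<rbrakk> \<Longrightarrow> iso_arrow C (Asc C a b c)"
    and assoc_natural: "\<lbrakk>f \<in> Hom C a a'; g \<in> Hom C b b'; h \<in> Hom C c c'\<rbrakk>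
        \<Longrightarrow> Asc C a' b' c' \<cdot> ((f \<boxtimes> g) \<boxtimes> h) = (f \<boxtimes> (g \<boxtimes> h)) \<cdot> Asc C a b c"
    and lunit_Hom: "a \<in> Ob C \<Longrightarrow> Lun C a \<in> Hom C (\<I> \<otimes> a) a"
    and lunit_iso: "a \<in> Ob C \<Longrightarrow> iso_arrow C (Lun C a)"
    and lunit_natural: "f \<in> Hom C a b \<Longrightarrow> Lun C b \<cdot> (\<one> \<I> \<boxtimes> f) = f \<cdot> Lun C a"
    and runit_Hom: "a \<in> Ob C \<Longrightarrow> Run C a \<in> Hom C (a \<otimes> \<I>) a"
    and runit_iso: "a \<in> Ob C \<Longrightarrow> iso_arrow C (Run C a)"
    and runit_natural: "f \<in> Hom C a b \<Longrightarrow> Run C b \<cdot> (f \<boxtimes> \<one> \<I>) = f \<cdot> Run C a"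
    and pentagon: "\<lbrakk>a \<in> Ob C; b \<in> Ob C; c \<in> Ob C; d \<in> Ob C\<rbrakk>
        \<Longrightarrow> Asc C a b (c \<otimes> d) \<cdot> Asc C (a \<otimes> b) c d =
            (\<one> a \<boxtimes> Asc C b c d) \<cdot> Asc C a (b \<otimes> c) d \<cdot> (Asc C a b c \<boxtimes> \<one> d)"
    and triangle: "\<lbrakk>a \<in> Ob C; b \<in> Ob C\<rbrakk>
        \<Longrightarrow> (\<one> a \<boxtimes> Lun C b) \<cdot> Asc C a \<I> b = Run C a \<boxtimes> \<one> b"
    and sym_Hom: "\<lbrakk>a \<in> Ob C; b \<in> Ob C\<rbrakk> \<Longrightarrow> Sym C a b \<in> Hom C (a \<otimes> b) (b \<otimes> a)"
    and sym_natural: "\<lbrakk>f \<in> Hom C a a'; g \<in> Hom C b b'\<rbrakk>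
        \<Longrightarrow> Sym C a' b' \<cdot> (f \<boxtimes> g) = (g \<boxtimes> f) \<cdot> Sym C a b"
    and sym_inverse: "\<lbrakk>a \<in> Ob C; b \<in> Ob C\<rbrakk> \<Longrightarrow> Sym C b a \<cdot> Sym C a b = \<one> (a \<otimes> b)"
    and sym_unit: "a \<in> Ob C \<Longrightarrow> Lun C a \<cdot> Sym C a \<I> = Run C a"
    and hexagon: "\<lbrakk>a \<in> Ob C; b \<in> Ob C; c \<in> Ob C\<rbrakk>
        \<Longrightarrow> Asc C b c a \<cdot> Sym C a (b \<otimes> c) \<cdot> Asc C a b c =
            (\<one> b \<boxtimes> Sym C a c) \<cdot> Asc C b a c \<cdot> (Sym C a b \<boxtimes> \<one> c)"

text \<open>\<open>IHom C y z\<close> is the internal hom \<open>[y;z]\<close> and \<open>Cur C y x z\<close> the bijection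
  \<open>Hom (y \<otimes> x) z \<rightarrow> Hom x [y;z]\<close>; the variable that is abstracted stands on the left of the tensor.
  Naturality in \<open>x\<close> is the representability of \<open>Hom (- \<otimes> y) z\<close> by \<open>[y;z]\<close>; the action of \<open>[y;-]\<close>
  on arrows is the unique one that makes the bijection natural in \<open>z\<close>, so it is not part of
  the data.\<close>

record ('o, 'a) csmcat = "('o, 'a) smcat" +
  IHom :: "'o \<Rightarrow> 'o \<Rightarrow> 'o"
  Cur :: "'o \<Rightarrow> 'o \<Rightarrow> 'o \<Rightarrow> 'a \<Rightarrow> 'a"

locale closed_symmetric_monoidal_category = symmetric_monoidal_category C
  for C :: "('o, 'a, 'm) csmcat_scheme" (structure) +
  assumes ihom_Ob: "\<lbrakk>y \<in> Ob C; z \<in> Ob C\<rbrakk> \<Longrightarrow> IHom C y z \<in> Ob C"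
    and cur_bij: "\<lbrakk>x \<in> Ob C; y \<in> Ob C; z \<in> Ob C\<rbrakk>
        \<Longrightarrow> bij_betw (Cur C y x z) (Hom C (y \<otimes> x) z) (Hom C x (IHom C y z))"
    and cur_natural: "\<lbrakk>y \<in> Ob C; f \<in> Hom C (y \<otimes> x) z; k \<in> Hom C x' x\<rbrakk>
        \<Longrightarrow> Cur C y x' z (f \<cdot> (\<one> y \<boxtimes> k)) = Cur C y x z f \<cdot> k"

definition uncur :: "('o, 'a, 'm) csmcat_scheme \<Rightarrow> 'o \<Rightarrow> 'o \<Rightarrow> 'o \<Rightarrow> 'a \<Rightarrow> 'a" where
  "uncur C y x z = inv_into (Hom C (y \<otimes>\<^bsub>C\<^esub> x) z) (Cur C y x z)"

definition eval_arrow :: "('o, 'a, 'm) csmcat_scheme \<Rightarrow> 'o \<Rightarrow> 'o \<Rightarrow> 'a" where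
  "eval_arrow C y z = uncur C y (IHom C y z) z (\<one>\<^bsub>C\<^esub> (IHom C y z))"

text \<open>The arrow \<open>[b;c] \<otimes> [a;b] \<rightarrow> [a;c]\<close> adjoint to
  \<open>a \<otimes> ([b;c] \<otimes> [a;b]) \<rightarrow> a \<otimes> ([a;b] \<otimes> [b;c]) \<rightarrow> (a \<otimes> [a;b]) \<otimes> [b;c] \<rightarrow> b \<otimes> [b;c] \<rightarrow> c\<close>.\<close>

definition icomp :: "('o, 'a, 'm) csmcat_scheme \<Rightarrow> 'o \<Rightarrow> 'o \<Rightarrow> 'o \<Rightarrow> 'a" where
  "icomp C a b c =
     Cur C a (IHom C b c \<otimes>\<^bsub>C\<^esub> IHom C a b) c
       (eval_arrow C b c
        \<cdot>\<^bsub>C\<^esub> (eval_arrow C a b \<boxtimes>\<^bsub>C\<^esub> \<one>\<^bsub>C\<^esub> (IHom C b c))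
        \<cdot>\<^bsub>C\<^esub> inv_arrow C (Asc C a (IHom C a b) (IHom C b c))
        \<cdot>\<^bsub>C\<^esub> (\<one>\<^bsub>C\<^esub> a \<boxtimes>\<^bsub>C\<^esub> Sym C (IHom C b c) (IHom C a b)))"

definition sharp :: "('o, 'a, 'm) csmcat_scheme \<Rightarrow> 'o \<Rightarrow> 'o \<Rightarrow> 'a \<Rightarrow> 'a" where
  "sharp C a b h = Cur C a \<I>\<^bsub>C\<^esub> b (h \<cdot>\<^bsub>C\<^esub> Run C a)"

definition unsharp :: "('o, 'a, 'm) csmcat_scheme \<Rightarrow> 'o \<Rightarrow> 'o \<Rightarrow> 'a \<Rightarrow> 'a" where
  "unsharp C a b k = uncur C a \<I>\<^bsub>C\<^esub> b k \<cdot>\<^bsub>C\<^esub> inv_arrow C (Run C a)"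

definition iident :: "('o, 'a, 'm) csmcat_scheme \<Rightarrow> 'o \<Rightarrow> 'a" where
  "iident C a = sharp C a a (\<one>\<^bsub>C\<^esub> a)"


record ('t, 'o, 'a) ecat =
  EOb :: "'t set"
  EHom :: "'t \<Rightarrow> 't \<Rightarrow> 'o"
  EComp :: "'t \<Rightarrow> 't \<Rightarrow> 't \<Rightarrow> 'a"
  EId :: "'t \<Rightarrow> 'a"

locale enriched_category = symmetric_monoidal_category C
  for C :: "('o, 'a, 'm) smcat_scheme" (structure) and A :: "('t, 'o, 'a) ecat" +
  assumes ehom_Ob: "\<lbrakk>x \<in> EOb A; y \<in> EOb A\<rbrakk> \<Longrightarrow> EHom A x y \<in> Ob C"
    and ecomp_Hom: "\<lbrakk>x \<in> EOb A; y \<in> EOb A; z \<in> EOb A\<rbrakk>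
        \<Longrightarrow> EComp A x y z \<in> Hom C (EHom A y z \<otimes> EHom A x y) (EHom A x z)"
    and eid_Hom: "x \<in> EOb A \<Longrightarrow> EId A x \<in> Hom C \<I> (EHom A x x)"
    and ecomp_assoc: "\<lbrakk>w \<in> EOb A; x \<in> EOb A; y \<in> EOb A; z \<in> EOb A\<rbrakk>
        \<Longrightarrow> EComp A w x z \<cdot> (EComp A x y z \<boxtimes> \<one> (EHom A w x)) =
            EComp A w y z \<cdot> (\<one> (EHom A y z) \<boxtimes> EComp A w x y)
              \<cdot> Asc C (EHom A y z) (EHom A x y) (EHom A w x)"
    and ecomp_id_left: "\<lbrakk>x \<in> EOb A; y \<in> EOb A\<rbrakk>
        \<Longrightarrow> EComp A x y y \<cdot> (EId A y \<boxtimes> \<one> (EHom A x y)) = Lun C (EHom A x y)"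
    and ecomp_id_right: "\<lbrakk>x \<in> EOb A; y \<in> EOb A\<rbrakk>
        \<Longrightarrow> EComp A x x y \<cdot> (\<one> (EHom A x y) \<boxtimes> EId A x) = Run C (EHom A x y)"

definition self_enriched :: "('o, 'a, 'm) csmcat_scheme \<Rightarrow> ('o, 'o, 'a) ecat" where
  "self_enriched C = \<lparr>EOb = Ob C, EHom = IHom C, EComp = icomp C, EId = iident C\<rparr>"

text \<open>Both components of an enriched functor, and the families of components of enriched natural
  transformations below, are extensional, so that HOL equality is equality of functors and of
  transformations.\<close>

record ('t, 's, 'a) efun =
  EFOb :: "'t \<Rightarrow> 's"
  EFHom :: "'t \<times> 't \<Rightarrow> 'a"

definition enriched_functor ::
  "('o, 'a, 'm) smcat_scheme \<Rightarrow> ('t, 'o, 'a) ecat \<Rightarrow> ('s, 'o, 'a) ecat \<Rightarrow>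
   ('t, 's, 'a) efun \<Rightarrow> bool" where
  "enriched_functor C A B F \<longleftrightarrow>
     EFOb F \<in> EOb A \<rightarrow>\<^sub>E EOb B \<and>
     EFHom F \<in> (\<Pi>\<^sub>E (x, y) \<in> EOb A \<times> EOb A. Hom C (EHom A x y) (EHom B (EFOb F x) (EFOb F y))) \<and>
     (\<forall>x \<in> EOb A. EFHom F (x, x) \<cdot>\<^bsub>C\<^esub> EId A x = EId B (EFOb F x)) \<and>
     (\<forall>x \<in> EOb A. \<forall>y \<in> EOb A. \<forall>z \<in> EOb A.
        EFHom F (x, z) \<cdot>\<^bsub>C\<^esub> EComp A x y z =
        EComp B (EFOb F x) (EFOb F y) (EFOb F z) \<cdot>\<^bsub>C\<^esub> (EFHom F (y, z) \<boxtimes>\<^bsub>C\<^esub> EFHom F (x, y)))"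

definition enriched_nat_trans ::
  "('o, 'a, 'm) smcat_scheme \<Rightarrow> ('t, 'o, 'a) ecat \<Rightarrow> ('s, 'o, 'a) ecat \<Rightarrow>
   ('t, 's, 'a) efun \<Rightarrow> ('t, 's, 'a) efun \<Rightarrow> ('t \<Rightarrow> 'a) \<Rightarrow> bool" where
  "enriched_nat_trans C A B F G \<eta> \<longleftrightarrow>
     \<eta> \<in> (\<Pi>\<^sub>E x \<in> EOb A. Hom C \<I>\<^bsub>C\<^esub> (EHom B (EFOb F x) (EFOb G x))) \<and>
     (\<forall>x \<in> EOb A. \<forall>y \<in> EOb A.
        EComp B (EFOb F x) (EFOb G x) (EFOb G y)
          \<cdot>\<^bsub>C\<^esub> (EFHom G (x, y) \<boxtimes>\<^bsub>C\<^esub> \<eta> x) \<cdot>\<^bsub>C\<^esub> inv_arrow C (Run C (EHom A x y)) =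
        EComp B (EFOb F x) (EFOb F y) (EFOb G y)
          \<cdot>\<^bsub>C\<^esub> (\<eta> y \<boxtimes>\<^bsub>C\<^esub> EFHom F (x, y)) \<cdot>\<^bsub>C\<^esub> inv_arrow C (Lun C (EHom A x y)))"

text \<open>In this and the following categories an arrow is a triple (source, underlying datum, target).\<close>

definition enriched_functor_cat ::
  "('o, 'a, 'm) smcat_scheme \<Rightarrow> ('t, 'o, 'a) ecat \<Rightarrow> ('s, 'o, 'a) ecat \<Rightarrow>
   (('t, 's, 'a) efun, ('t, 's, 'a) efun \<times> ('t \<Rightarrow> 'a) \<times> ('t, 's, 'a) efun) cat" where
  "enriched_functor_cat C A B =
     \<lparr>Ob = {F. enriched_functor C A B F},
      Arr = {(F, \<eta>, G). enriched_functor C A B F \<and> enriched_functor C A B G \<and>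
               enriched_nat_trans C A B F G \<eta>},
      Dom = (\<lambda>(F, \<eta>, G). F),
      Cod = (\<lambda>(F, \<eta>, G). G),
      Idm = (\<lambda>F. (F, (\<lambda>x \<in> EOb A. EId B (EFOb F x)), F)),
      Cmp = (\<lambda>(G, \<theta>, H) (F, \<eta>, _).
               (F,
                (\<lambda>x \<in> EOb A. EComp B (EFOb F x) (EFOb G x) (EFOb H x)
                   \<cdot>\<^bsub>C\<^esub> (\<theta> x \<boxtimes>\<^bsub>C\<^esub> \<eta> x) \<cdot>\<^bsub>C\<^esub> inv_arrow C (Lun C \<I>\<^bsub>C\<^esub>)),
                H))\<rparr>"


definition enriched_action_cat ::
  "('o, 'a, 'm) csmcat_scheme \<Rightarrow> ('t, 'o, 'a) ecat \<Rightarrow>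
   (('t, 'o, 'a) efun, ('t, 'o, 'a) efun \<times> ('t \<Rightarrow> 'a) \<times> ('t, 'o, 'a) efun) cat" where
  "enriched_action_cat C \<T> = enriched_functor_cat C \<T> (self_enriched C)"

definition left_action ::
  "('o, 'a, 'm) smcat_scheme \<Rightarrow> 'o \<Rightarrow> 'a \<Rightarrow> 'a \<Rightarrow> 'o \<times> 'a \<Rightarrow> bool" where
  "left_action C T \<mu> \<iota> = (\<lambda>(\<Omega>, \<Psi>).
     \<Omega> \<in> Ob C \<and> \<Psi> \<in> Hom C (T \<otimes>\<^bsub>C\<^esub> \<Omega>) \<Omega> \<and>
     \<Psi> \<cdot>\<^bsub>C\<^esub> (\<iota> \<boxtimes>\<^bsub>C\<^esub> \<one>\<^bsub>C\<^esub> \<Omega>) = Lun C \<Omega> \<and>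
     \<Psi> \<cdot>\<^bsub>C\<^esub> (\<one>\<^bsub>C\<^esub> T \<boxtimes>\<^bsub>C\<^esub> \<Psi>) \<cdot>\<^bsub>C\<^esub> Asc C T T \<Omega> = \<Psi> \<cdot>\<^bsub>C\<^esub> (\<mu> \<boxtimes>\<^bsub>C\<^esub> \<one>\<^bsub>C\<^esub> \<Omega>))"

definition left_action_cat ::
  "('o, 'a, 'm) smcat_scheme \<Rightarrow> 'o \<Rightarrow> 'a \<Rightarrow> 'a \<Rightarrow>
   ('o \<times> 'a, ('o \<times> 'a) \<times> 'a \<times> ('o \<times> 'a)) cat" where
  "left_action_cat C T \<mu> \<iota> =
     \<lparr>Ob = {p. left_action C T \<mu> \<iota> p},
      Arr = {((\<Omega>, \<Psi>), h, (\<Omega>', \<Psi>')).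
               left_action C T \<mu> \<iota> (\<Omega>, \<Psi>) \<and> left_action C T \<mu> \<iota> (\<Omega>', \<Psi>') \<and>
               h \<in> Hom C \<Omega> \<Omega>' \<and> h \<cdot>\<^bsub>C\<^esub> \<Psi> = \<Psi>' \<cdot>\<^bsub>C\<^esub> (\<one>\<^bsub>C\<^esub> T \<boxtimes>\<^bsub>C\<^esub> h)},
      Dom = (\<lambda>(p, h, q). p),
      Cod = (\<lambda>(p, h, q). q),
      Idm = (\<lambda>p. (p, \<one>\<^bsub>C\<^esub> (fst p), p)),
      Cmp = (\<lambda>(q, k, r) (p, h, _). (p, k \<cdot>\<^bsub>C\<^esub> h, r))\<rparr>"

text \<open>The adjunction of the internal hom abstracts the left tensor factor, whereas the acting
  object \<open>T\<close> stands on the left in \<open>T \<otimes> \<Omega>\<close>; hence the symmetry in the two passages between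
  \<open>T \<rightarrow> [\<Omega>;\<Omega>]\<close> and \<open>T \<otimes> \<Omega> \<rightarrow> \<Omega>\<close>.\<close>

definition adjoint_action :: "('o, 'a, 'm) csmcat_scheme \<Rightarrow> 'o \<Rightarrow> 'o \<times> 'a \<Rightarrow> 'o \<times> 'a" where
  "adjoint_action C T = (\<lambda>(\<Omega>, \<phi>). (\<Omega>, uncur C \<Omega> T \<Omega> \<phi> \<cdot>\<^bsub>C\<^esub> Sym C T \<Omega>))"

definition adjoint_endo :: "('o, 'a, 'm) csmcat_scheme \<Rightarrow> 'o \<Rightarrow> 'o \<times> 'a \<Rightarrow> 'o \<times> 'a" where
  "adjoint_endo C T = (\<lambda>(\<Omega>, \<Psi>). (\<Omega>, Cur C \<Omega> T \<Omega> (\<Psi> \<cdot>\<^bsub>C\<^esub> Sym C \<Omega> T)))"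

definition param_endo ::
  "('o, 'a, 'm) csmcat_scheme \<Rightarrow> 'o \<Rightarrow> 'a \<Rightarrow> 'a \<Rightarrow> 'o \<times> 'a \<Rightarrow> bool" where
  "param_endo C T \<mu> \<iota> = (\<lambda>(\<Omega>, \<phi>).
     \<Omega> \<in> Ob C \<and> \<phi> \<in> Hom C T (IHom C \<Omega> \<Omega>) \<and>
     \<phi> \<cdot>\<^bsub>C\<^esub> \<iota> = iident C \<Omega> \<and>
     \<phi> \<cdot>\<^bsub>C\<^esub> \<mu> = icomp C \<Omega> \<Omega> \<Omega> \<cdot>\<^bsub>C\<^esub> (\<phi> \<boxtimes>\<^bsub>C\<^esub> \<phi>))"

text \<open>Arrows, identities and composition are those of \<open>left_action_cat\<close> between the adjoints.\<close>

definition param_endo_cat ::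
  "('o, 'a, 'm) csmcat_scheme \<Rightarrow> 'o \<Rightarrow> 'a \<Rightarrow> 'a \<Rightarrow>
   ('o \<times> 'a, ('o \<times> 'a) \<times> 'a \<times> ('o \<times> 'a)) cat" where
  "param_endo_cat C T \<mu> \<iota> =
     (let L = left_action_cat C T \<mu> \<iota>; adj = adjoint_action C T in
      \<lparr>Ob = {p. param_endo C T \<mu> \<iota> p},
       Arr = {(p, h, q). param_endo C T \<mu> \<iota> p \<and> param_endo C T \<mu> \<iota> q \<and>
                (adj p, h, adj q) \<in> Hom L (adj p) (adj q)},
       Dom = (\<lambda>(p, h, q). p),
       Cod = (\<lambda>(p, h, q). q),
       Idm = (\<lambda>p. (p, fst (snd (\<one>\<^bsub>L\<^esub> (adj p))), p)),
       Cmp = (\<lambda>(q, k, r) (p, h, q').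
                (p, fst (snd ((adj q, k, adj r) \<cdot>\<^bsub>L\<^esub> (adj p, h, adj q'))), r))\<rparr>)"


text \<open>In the following, \<open>s\<close> is the unique object of the one-object enriched category \<open>\<T>\<close>.\<close>

definition parametric_form :: "'t \<Rightarrow> ('t, 'o, 'a) efun \<Rightarrow> 'o \<times> 'a" where
  "parametric_form s F = (EFOb F s, EFHom F (s, s))"

definition parametric_functor ::
  "('o, 'a, 'm) csmcat_scheme \<Rightarrow> 't \<Rightarrow>
   (('t, 'o, 'a) efun, ('t, 'o, 'a) efun \<times> ('t \<Rightarrow> 'a) \<times> ('t, 'o, 'a) efun,
    'o \<times> 'a, ('o \<times> 'a) \<times> 'a \<times> ('o \<times> 'a)) cfun" where
  "parametric_functor C s =
     \<lparr>FOb = parametric_form s,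
      FArr = (\<lambda>(F, \<eta>, G).
        (parametric_form s F, unsharp C (EFOb F s) (EFOb G s) (\<eta> s), parametric_form s G))\<rparr>"

definition enriched_form :: "'t \<Rightarrow> 'o \<times> 'a \<Rightarrow> ('t, 'o, 'a) efun" where
  "enriched_form s = (\<lambda>(\<Omega>, \<phi>). \<lparr>EFOb = (\<lambda>x \<in> {s}. \<Omega>), EFHom = (\<lambda>p \<in> {(s, s)}. \<phi>)\<rparr>)"

definition enriched_form_functor ::
  "('o, 'a, 'm) csmcat_scheme \<Rightarrow> 't \<Rightarrow>
   ('o \<times> 'a, ('o \<times> 'a) \<times> 'a \<times> ('o \<times> 'a),
    ('t, 'o, 'a) efun, ('t, 'o, 'a) efun \<times> ('t \<Rightarrow> 'a) \<times> ('t, 'o, 'a) efun) cfun" where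
  "enriched_form_functor C s =
     \<lparr>FOb = enriched_form s,
      FArr = (\<lambda>(p, h, q).
        (enriched_form s p, (\<lambda>x \<in> {s}. sharp C (fst p) (fst q) h), enriched_form s q))\<rparr>"

definition adjoint_action_functor ::
  "('o, 'a, 'm) csmcat_scheme \<Rightarrow> 'o \<Rightarrow>
   ('o \<times> 'a, ('o \<times> 'a) \<times> 'a \<times> ('o \<times> 'a), 'o \<times> 'a, ('o \<times> 'a) \<times> 'a \<times> ('o \<times> 'a)) cfun" where
  "adjoint_action_functor C T =
     \<lparr>FOb = adjoint_action C T,
      FArr = (\<lambda>(p, h, q). (adjoint_action C T p, h, adjoint_action C T q))\<rparr>"

definition adjoint_endo_functor ::
  "('o, 'a, 'm) csmcat_scheme \<Rightarrow> 'o \<Rightarrow>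
   ('o \<times> 'a, ('o \<times> 'a) \<times> 'a \<times> ('o \<times> 'a), 'o \<times> 'a, ('o \<times> 'a) \<times> 'a \<times> ('o \<times> 'a)) cfun" where
  "adjoint_endo_functor C T =
     \<lparr>FOb = adjoint_endo C T,
      FArr = (\<lambda>(p, h, q). (adjoint_endo C T p, h, adjoint_endo C T q))\<rparr>"

definition enriched_to_left_action ::
  "('o, 'a, 'm) csmcat_scheme \<Rightarrow> 't \<Rightarrow> 'o \<Rightarrow> ('t, 'o, 'a) efun \<Rightarrow> 'o \<times> 'a" where
  "enriched_to_left_action C s T F =
     (EFOb F s, uncur C (EFOb F s) T (EFOb F s) (EFHom F (s, s)) \<cdot>\<^bsub>C\<^esub> Sym C T (EFOb F s))"

definition enriched_to_left_action_functor ::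
  "('o, 'a, 'm) csmcat_scheme \<Rightarrow> 't \<Rightarrow> 'o \<Rightarrow>
   (('t, 'o, 'a) efun, ('t, 'o, 'a) efun \<times> ('t \<Rightarrow> 'a) \<times> ('t, 'o, 'a) efun,
    'o \<times> 'a, ('o \<times> 'a) \<times> 'a \<times> ('o \<times> 'a)) cfun" where
  "enriched_to_left_action_functor C s T =
     \<lparr>FOb = enriched_to_left_action C s T,
      FArr = (\<lambda>(F, \<eta>, G).
        (enriched_to_left_action C s T F,
         unsharp C (EFOb F s) (EFOb G s) (\<eta> s),
         enriched_to_left_action C s T G))\<rparr>"

end

theory Submission
  imports Defs
begin

text \<open>
  Everything is compared with left actions.  An arrow \<open>\<phi> : x \<rightarrow> [a;b]\<close> has a transpose
  \<open>x \<otimes> a \<rightarrow> b\<close>, and transposition is injective and natural in \<open>x\<close>.  Internal composition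
  becomes iterated action: the transpose of \<open>\<circ> (\<phi> \<otimes> \<psi>)\<close> applies that of \<open>\<psi>\<close> and then
  that of \<open>\<phi>\<close> (\<open>left_transpose_icomp\<close>, where the hexagon enters through \<open>sym_reverse\<close>).  The transpose
  of \<open>h\<^sup>\<sharp> : 1 \<rightarrow> [a;b]\<close> is \<open>h\<close> after the left unitor (\<open>left_transpose_sharp\<close>).

  Hence the two equations for \<open>\<Phi>\<^sup>\<sharp> : T \<rightarrow> [\<Omega>;\<Omega>]\<close> transpose to the unit and associativity laws of a
  left action (\<open>left_action_left_transpose_iff\<close>).  By the triangle and Kelly's coherence
  \<open>lunit_tensor\<close>, the naturality square of \<open>h\<^sup>\<sharp>\<close> transposes to the equivariance of \<open>h\<close>
  (\<open>sharp_natural_iff_equivariant\<close>), and composition of enriched transformations is composition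
  in \<open>C\<close> (\<open>sharp_comp\<close>).

  Left actions form a category because \<open>C\<close> is one.  The passages from enriched functors to
  parameterized endomorphisms and from these to left actions are bijective on objects and on
  hom-sets and respect identities and composition, so they carry the category axioms back
  (\<open>faithful_functorI\<close>) and are isomorphisms (\<open>inverse_functorsI\<close>).  With a single object in
  the source, an enriched functor is determined by its parametric form and a transformation by
  its one component, since both are extensional.
\<close>

section \<open>Arrows in a category\<close>

context category
begin

lemma in_Hom_iff: "f \<in> Hom C a b \<longleftrightarrow> f \<in> Arr C \<and> Dom C f = a \<and> Cod C f = b"
  by (auto simp: Hom_def)

lemma dom_in_Ob [simp]: "f \<in> Arr C \<Longrightarrow> Dom C f \<in> Ob C"
  by (rule dom_Ob)

lemma cod_in_Ob [simp]: "f \<in> Arr C \<Longrightarrow> Cod C f \<in> Ob C"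
  by (rule cod_Ob)

lemma Hom_Ob: "f \<in> Hom C a b \<Longrightarrow> a \<in> Ob C \<and> b \<in> Ob C"
  by (auto simp: in_Hom_iff)

lemma id_arr [simp]:
  assumes "a \<in> Ob C"
  shows "\<one> a \<in> Arr C" "Dom C (\<one> a) = a" "Cod C (\<one> a) = a"
  using id_Hom[OF assms] by (auto simp: in_Hom_iff)

lemma comp_arr [simp]:
  assumes "f \<in> Arr C" "g \<in> Arr C" "Dom C g = Cod C f"
  shows "g \<cdot> f \<in> Arr C" "Dom C (g \<cdot> f) = Dom C f" "Cod C (g \<cdot> f) = Cod C g"
  using comp_Hom[of f "Dom C f" "Cod C f" g "Cod C g"] assms by (auto simp: in_Hom_iff)

lemma id_comp [simp]: "\<lbrakk>f \<in> Arr C; Cod C f = b\<rbrakk> \<Longrightarrow> \<one> b \<cdot> f = f"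
  using comp_id_left[of f "Dom C f" b] by (auto simp: in_Hom_iff)

lemma comp_id [simp]: "\<lbrakk>f \<in> Arr C; Dom C f = a\<rbrakk> \<Longrightarrow> f \<cdot> \<one> a = f"
  using comp_id_right[of f a "Cod C f"] by (auto simp: in_Hom_iff)

lemma assoc:
  "\<lbrakk>f \<in> Arr C; g \<in> Arr C; h \<in> Arr C; Dom C g = Cod C f; Dom C h = Cod C g\<rbrakk>
    \<Longrightarrow> (h \<cdot> g) \<cdot> f = h \<cdot> (g \<cdot> f)"
  using comp_assoc[of f "Dom C f" "Cod C f" g "Cod C g" h "Cod C h"] by (auto simp: in_Hom_iff)

lemma comp_eq_extend:
  assumes "g \<cdot> f = h" "f \<in> Arr C" "g \<in> Arr C" "k \<in> Arr C" "Dom C g = Cod C f" "Dom C f = Cod C k"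
  shows "g \<cdot> (f \<cdot> k) = h \<cdot> k"
  using assms assoc[of k f g] by simp

lemma inverse_arrows_unique:
  assumes "inverse_arrows C f g" "inverse_arrows C f g'"
  shows "g = g'"
proof -
  have g: "f \<in> Arr C" "g \<in> Arr C" "Dom C g = Cod C f" "Cod C g = Dom C f"
      "g \<cdot> f = \<one> (Dom C f)" "f \<cdot> g = \<one> (Cod C f)"
    and g': "g' \<in> Arr C" "Dom C g' = Cod C f" "Cod C g' = Dom C f"
      "g' \<cdot> f = \<one> (Dom C f)" "f \<cdot> g' = \<one> (Cod C f)"
    using assms by (auto simp: inverse_arrows_def in_Hom_iff)
  have "g = (g' \<cdot> f) \<cdot> g" using g g' by simp
  also have "\<dots> = g' \<cdot> (f \<cdot> g)" using g g'(1-3) by (simp add: assoc)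
  also have "\<dots> = g'" using g g' by simp
  finally show ?thesis .
qed

lemma inverse_arrows_inv_arrow: "iso_arrow C f \<Longrightarrow> inverse_arrows C f (inv_arrow C f)"
  unfolding iso_arrow_def inv_arrow_def by (metis inverse_arrows_unique theI)

lemma iso_in_Arr: "iso_arrow C f \<Longrightarrow> f \<in> Arr C"
  by (auto simp: iso_arrow_def inverse_arrows_def)

lemma inv_arr [simp]:
  assumes "iso_arrow C f"
  shows "inv_arrow C f \<in> Arr C" "Dom C (inv_arrow C f) = Cod C f" "Cod C (inv_arrow C f) = Dom C f"
    "inv_arrow C f \<cdot> f = \<one> (Dom C f)" "f \<cdot> inv_arrow C f = \<one> (Cod C f)"
  using inverse_arrows_inv_arrow[OF assms] by (auto simp: inverse_arrows_def in_Hom_iff)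

lemma inv_cancel [simp]:
  assumes "iso_arrow C f" "k \<in> Arr C"
  shows "Cod C k = Dom C f \<Longrightarrow> inv_arrow C f \<cdot> (f \<cdot> k) = k"
    "Cod C k = Cod C f \<Longrightarrow> f \<cdot> (inv_arrow C f \<cdot> k) = k"
  using assms iso_in_Arr[OF assms(1)] by (simp_all add: assoc[symmetric])

lemma iso_cancel_right:
  assumes "f \<cdot> k = g \<cdot> k" "iso_arrow C k" "f \<in> Arr C" "g \<in> Arr C" "Dom C f = Cod C k" "Dom C g = Cod C k"
  shows "f = g"
proof -
  have "(f \<cdot> k) \<cdot> inv_arrow C k = (g \<cdot> k) \<cdot> inv_arrow C k" using assms by simp
  then show ?thesis using assms(2-) iso_in_Arr[OF assms(2)] by (simp add: assoc)
qed

end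


section \<open>Coherence in a symmetric monoidal category\<close>

context symmetric_monoidal_category
begin

declare tensor_Ob [simp] unit_Ob [simp] assoc_iso [simp] lunit_iso [simp] runit_iso [simp]

lemma tensor_arr [simp]:
  assumes "f \<in> Arr C" "g \<in> Arr C"
  shows "f \<boxtimes> g \<in> Arr C" "Dom C (f \<boxtimes> g) = Dom C f \<otimes> Dom C g" "Cod C (f \<boxtimes> g) = Cod C f \<otimes> Cod C g"
  using tensor_Hom[of f "Dom C f" "Cod C f" g "Dom C g" "Cod C g"] assms by (auto simp: in_Hom_iff)

lemma assoc_arr [simp]:
  assumes "a \<in> Ob C" "b \<in> Ob C" "c \<in> Ob C"
  shows "Asc C a b c \<in> Arr C" "Dom C (Asc C a b c) = (a \<otimes> b) \<otimes> c"
    "Cod C (Asc C a b c) = a \<otimes> (b \<otimes> c)"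
  using assoc_Hom[OF assms] by (auto simp: in_Hom_iff)

lemma lunit_arr [simp]:
  assumes "a \<in> Ob C"
  shows "Lun C a \<in> Arr C" "Dom C (Lun C a) = \<I> \<otimes> a" "Cod C (Lun C a) = a"
  using lunit_Hom[OF assms] by (auto simp: in_Hom_iff)

lemma runit_arr [simp]:
  assumes "a \<in> Ob C"
  shows "Run C a \<in> Arr C" "Dom C (Run C a) = a \<otimes> \<I>" "Cod C (Run C a) = a"
  using runit_Hom[OF assms] by (auto simp: in_Hom_iff)

lemma sym_arr [simp]:
  assumes "a \<in> Ob C" "b \<in> Ob C"
  shows "Sym C a b \<in> Arr C" "Dom C (Sym C a b) = a \<otimes> b" "Cod C (Sym C a b) = b \<otimes> a"
  using sym_Hom[OF assms] by (auto simp: in_Hom_iff)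

lemma tensor_comp:
  "\<lbrakk>f \<in> Arr C; g \<in> Arr C; f' \<in> Arr C; g' \<in> Arr C; Dom C g = Cod C f; Dom C g' = Cod C f'\<rbrakk>
    \<Longrightarrow> (g \<boxtimes> g') \<cdot> (f \<boxtimes> f') = (g \<cdot> f) \<boxtimes> (g' \<cdot> f')"
  using interchange[of f "Dom C f" "Cod C f" g "Cod C g" f' "Dom C f'" "Cod C f'" g' "Cod C g'"]
  by (auto simp: in_Hom_iff)

lemma tensor_comp_extend:
  "\<lbrakk>f \<in> Arr C; g \<in> Arr C; f' \<in> Arr C; g' \<in> Arr C; Dom C g = Cod C f; Dom C g' = Cod C f';
    k \<in> Arr C; Cod C k = Dom C f \<otimes> Dom C f'\<rbrakk>
    \<Longrightarrow> (g \<boxtimes> g') \<cdot> ((f \<boxtimes> f') \<cdot> k) = ((g \<cdot> f) \<boxtimes> (g' \<cdot> f')) \<cdot> k"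
  by (rule comp_eq_extend) (simp_all add: tensor_comp)

lemma assoc_nat:
  "\<lbrakk>f \<in> Arr C; g \<in> Arr C; h \<in> Arr C\<rbrakk> \<Longrightarrow>
    Asc C (Cod C f) (Cod C g) (Cod C h) \<cdot> ((f \<boxtimes> g) \<boxtimes> h) =
    (f \<boxtimes> (g \<boxtimes> h)) \<cdot> Asc C (Dom C f) (Dom C g) (Dom C h)"
  by (rule assoc_natural) (simp_all add: in_Hom_iff)

lemma assoc_inv_nat:
  assumes [simp]: "f \<in> Arr C" "g \<in> Arr C" "h \<in> Arr C"
  shows "inv_arrow C (Asc C (Cod C f) (Cod C g) (Cod C h)) \<cdot> (f \<boxtimes> (g \<boxtimes> h)) =
    ((f \<boxtimes> g) \<boxtimes> h) \<cdot> inv_arrow C (Asc C (Dom C f) (Dom C g) (Dom C h))"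
    (is "inv_arrow C ?B \<cdot> ?r = ?l \<cdot> inv_arrow C ?A")
proof -
  have "inv_arrow C ?B \<cdot> ?r = inv_arrow C ?B \<cdot> ((?r \<cdot> ?A) \<cdot> inv_arrow C ?A)"
    by (simp add: assoc)
  also have "\<dots> = inv_arrow C ?B \<cdot> ((?B \<cdot> ?l) \<cdot> inv_arrow C ?A)"
    by (simp only: assoc_nat assms)
  also have "\<dots> = ?l \<cdot> inv_arrow C ?A"
    by (simp add: assoc)
  finally show ?thesis .
qed

lemma lunit_nat:
  "\<lbrakk>f \<in> Arr C; Dom C f = a; Cod C f = b\<rbrakk> \<Longrightarrow> Lun C b \<cdot> (\<one> \<I> \<boxtimes> f) = f \<cdot> Lun C a"
  by (rule lunit_natural) (simp add: in_Hom_iff)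

lemma sym_nat:
  "\<lbrakk>f \<in> Arr C; g \<in> Arr C; Cod C f = a'; Cod C g = b'; Dom C f = a; Dom C g = b\<rbrakk>
    \<Longrightarrow> Sym C a' b' \<cdot> (f \<boxtimes> g) = (g \<boxtimes> f) \<cdot> Sym C a b"
  by (rule sym_natural) (simp_all add: in_Hom_iff)

lemma sym_sym [simp]: "\<lbrakk>a \<in> Ob C; b \<in> Ob C\<rbrakk> \<Longrightarrow> Sym C b a \<cdot> Sym C a b = \<one> (a \<otimes> b)"
  by (rule sym_inverse)

lemma sym_sym_cancel [simp]:
  "\<lbrakk>a \<in> Ob C; b \<in> Ob C; k \<in> Arr C; Cod C k = a \<otimes> b\<rbrakk> \<Longrightarrow> Sym C b a \<cdot> (Sym C a b \<cdot> k) = k"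
  by (simp add: assoc[symmetric])

lemma sym_iso [simp]:
  assumes "a \<in> Ob C" "b \<in> Ob C"
  shows "iso_arrow C (Sym C a b)"
  unfolding iso_arrow_def inverse_arrows_def
  using assms by (intro exI[of _ "Sym C b a"]) (simp add: in_Hom_iff)

lemma tensor_iso:
  assumes "iso_arrow C f" "iso_arrow C g"
  shows "iso_arrow C (f \<boxtimes> g)"
  unfolding iso_arrow_def inverse_arrows_def
  using assms assms[THEN iso_in_Arr]
  by (intro exI[of _ "inv_arrow C f \<boxtimes> inv_arrow C g"])
    (simp add: in_Hom_iff tensor_comp tensor_id)

lemma id_iso [simp]: "a \<in> Ob C \<Longrightarrow> iso_arrow C (\<one> a)"
  unfolding iso_arrow_def inverse_arrows_def
  by (intro exI[of _ "\<one> a"]) (simp add: in_Hom_iff)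

lemma comp_iso:
  assumes "iso_arrow C f" "iso_arrow C g" "Dom C g = Cod C f"
  shows "iso_arrow C (g \<cdot> f)"
  unfolding iso_arrow_def inverse_arrows_def
  using assms assms(1,2)[THEN iso_in_Arr]
  by (intro exI[of _ "inv_arrow C f \<cdot> inv_arrow C g"]) (simp add: in_Hom_iff assoc)

lemma lunit_faithful:
  assumes "\<one> \<I> \<boxtimes> f = \<one> \<I> \<boxtimes> g" "f \<in> Hom C a b" "g \<in> Hom C a b"
  shows "f = g"
proof (rule iso_cancel_right[of _ "Lun C a"])
  show "f \<cdot> Lun C a = g \<cdot> Lun C a"
    using assms by (metis lunit_natural)
qed (use assms(2,3) in \<open>auto simp: in_Hom_iff\<close>)

text \<open>Kelly's consequence of the pentagon and the triangle.  It suffices to prove the equation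
  after tensoring with the unit object on the left.\<close>

lemma lunit_tensor:
  assumes [simp]: "a \<in> Ob C" "b \<in> Ob C"
  shows "Lun C (a \<otimes> b) \<cdot> Asc C \<I> a b = Lun C a \<boxtimes> \<one> b"
proof (rule lunit_faithful)
  \<comment> \<open>Two of the three associators on the longer side of the pentagon for \<open>\<I>, \<I>, a, b\<close>; being
    an isomorphism, their composite can be cancelled.\<close>
  let ?e = "Asc C \<I> (\<I> \<otimes> a) b \<cdot> (Asc C \<I> \<I> a \<boxtimes> \<one> b)"
  let ?i = "\<one> \<I>"
  have "(?i \<boxtimes> (Lun C (a \<otimes> b) \<cdot> Asc C \<I> a b)) \<cdot> ?e
      = (?i \<boxtimes> Lun C (a \<otimes> b)) \<cdot> ((?i \<boxtimes> Asc C \<I> a b) \<cdot> ?e)"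
    by (simp add: tensor_comp_extend)
  also have "\<dots> = (?i \<boxtimes> Lun C (a \<otimes> b)) \<cdot> (Asc C \<I> \<I> (a \<otimes> b) \<cdot> Asc C (\<I> \<otimes> \<I>) a b)"
    by (simp add: pentagon)
  also have "\<dots> = (Run C \<I> \<boxtimes> \<one> (a \<otimes> b)) \<cdot> Asc C (\<I> \<otimes> \<I>) a b"
    by (rule comp_eq_extend[OF triangle]) simp_all
  also have "\<dots> = (Run C \<I> \<boxtimes> (\<one> a \<boxtimes> \<one> b)) \<cdot> Asc C (\<I> \<otimes> \<I>) a b"
    by (simp add: tensor_id)
  also have "\<dots> = Asc C \<I> a b \<cdot> ((Run C \<I> \<boxtimes> \<one> a) \<boxtimes> \<one> b)"
    using assoc_nat[of "Run C \<I>" "\<one> a" "\<one> b"] by simp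
  also have "\<dots> = Asc C \<I> a b \<cdot> (((?i \<boxtimes> Lun C a) \<boxtimes> \<one> b) \<cdot> (Asc C \<I> \<I> a \<boxtimes> \<one> b))"
    by (simp add: tensor_comp triangle)
  also have "\<dots> = (Asc C \<I> a b \<cdot> ((?i \<boxtimes> Lun C a) \<boxtimes> \<one> b)) \<cdot> (Asc C \<I> \<I> a \<boxtimes> \<one> b)"
    by (simp add: assoc)
  also have "\<dots> = (?i \<boxtimes> (Lun C a \<boxtimes> \<one> b)) \<cdot> ?e"
    using assoc_nat[of ?i "Lun C a" "\<one> b"] by (simp add: assoc)
  finally have "(?i \<boxtimes> (Lun C (a \<otimes> b) \<cdot> Asc C \<I> a b)) \<cdot> ?e = (?i \<boxtimes> (Lun C a \<boxtimes> \<one> b)) \<cdot> ?e" .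
  then show "?i \<boxtimes> (Lun C (a \<otimes> b) \<cdot> Asc C \<I> a b) = ?i \<boxtimes> (Lun C a \<boxtimes> \<one> b)"
    by (rule iso_cancel_right) (simp_all add: comp_iso tensor_iso)
qed (simp_all add: in_Hom_iff)

lemma runit_sym: "a \<in> Ob C \<Longrightarrow> Run C a \<cdot> Sym C \<I> a = Lun C a"
  by (simp add: sym_unit[symmetric] assoc)

text \<open>The other hexagon: the symmetry past a tensor product on its left.\<close>

lemma sym_tensor_left:
  assumes [simp]: "x \<in> Ob C" "y \<in> Ob C" "a \<in> Ob C"
  shows "Sym C (x \<otimes> y) a =
    Asc C a x y \<cdot> (Sym C x a \<boxtimes> \<one> y) \<cdot> inv_arrow C (Asc C x a y) \<cdot> (\<one> x \<boxtimes> Sym C y a) \<cdot> Asc C x y a"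
    (is "_ = ?R")
proof -
  \<comment> \<open>\<open>?R\<close> is a left inverse of \<open>Sym C a (x \<otimes> y)\<close>, by the hexagon for \<open>a, x, y\<close>\<close>
  have "?R \<cdot> (Sym C a (x \<otimes> y) \<cdot> Asc C a x y)
      = Asc C a x y \<cdot> (Sym C x a \<boxtimes> \<one> y) \<cdot> inv_arrow C (Asc C x a y) \<cdot> (\<one> x \<boxtimes> Sym C y a)
          \<cdot> (Asc C x y a \<cdot> Sym C a (x \<otimes> y) \<cdot> Asc C a x y)"
    by (simp add: assoc)
  also have "\<dots> = Asc C a x y \<cdot> (Sym C x a \<boxtimes> \<one> y) \<cdot> inv_arrow C (Asc C x a y)
      \<cdot> (\<one> x \<boxtimes> Sym C y a) \<cdot> (\<one> x \<boxtimes> Sym C a y) \<cdot> Asc C x a y \<cdot> (Sym C a x \<boxtimes> \<one> y)"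
    by (simp only: hexagon assms)
  also have "\<dots> = Asc C a x y"
    by (simp add: tensor_comp_extend tensor_comp tensor_id)
  finally have "(?R \<cdot> Sym C a (x \<otimes> y)) \<cdot> Asc C a x y = \<one> (a \<otimes> (x \<otimes> y)) \<cdot> Asc C a x y"
    by (simp add: assoc)
  then have "?R \<cdot> Sym C a (x \<otimes> y) = \<one> (a \<otimes> (x \<otimes> y))"
    by (rule iso_cancel_right) simp_all
  then have "?R \<cdot> Sym C a (x \<otimes> y) = Sym C (x \<otimes> y) a \<cdot> Sym C a (x \<otimes> y)"
    by simp
  then show ?thesis
    by (intro iso_cancel_right[of "Sym C (x \<otimes> y) a" "Sym C a (x \<otimes> y)"]) simp_all
qed

text \<open>The two ways of reversing a triple tensor product agree.\<close>

lemma sym_reverse: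
  assumes [simp]: "x \<in> Ob C" "y \<in> Ob C" "a \<in> Ob C"
  shows "inv_arrow C (Asc C a y x) \<cdot> (\<one> a \<boxtimes> Sym C x y) \<cdot> Sym C (x \<otimes> y) a =
    Sym C x (a \<otimes> y) \<cdot> (\<one> x \<boxtimes> Sym C y a) \<cdot> Asc C x y a"
proof -
  let ?k = "inv_arrow C (Asc C x a y) \<cdot> (\<one> x \<boxtimes> Sym C y a) \<cdot> Asc C x y a"
  have "(\<one> a \<boxtimes> Sym C x y) \<cdot> Sym C (x \<otimes> y) a
      = ((\<one> a \<boxtimes> Sym C x y) \<cdot> Asc C a x y \<cdot> (Sym C x a \<boxtimes> \<one> y)) \<cdot> ?k"
    by (simp add: sym_tensor_left assoc)
  \<comment> \<open>the hexagon for \<open>x, a, y\<close>\<close>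
  also have "\<dots> = (Asc C a y x \<cdot> Sym C x (a \<otimes> y) \<cdot> Asc C x a y) \<cdot> ?k"
    by (simp only: hexagon assms)
  also have "\<dots> = Asc C a y x \<cdot> Sym C x (a \<otimes> y) \<cdot> (\<one> x \<boxtimes> Sym C y a) \<cdot> Asc C x y a"
    by (simp add: assoc)
  finally show ?thesis by simp
qed

end

section \<open>Transposition across the internal hom\<close>

text \<open>The transpose of \<open>\<phi> : x \<rightarrow> [a;b]\<close> with the acting object on the left, \<open>x \<otimes> a \<rightarrow> b\<close>; the
  symmetry is needed because \<open>uncur\<close> gives an arrow out of \<open>a \<otimes> x\<close>.\<close>

definition left_transpose ::
  "('o, 'a, 'm) csmcat_scheme \<Rightarrow> 'o \<Rightarrow> 'o \<Rightarrow> 'o \<Rightarrow> 'a \<Rightarrow> 'a" where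
  "left_transpose C x a b \<phi> = uncur C a x b \<phi> \<cdot>\<^bsub>C\<^esub> Sym C x a"

context closed_symmetric_monoidal_category
begin

declare ihom_Ob [simp]

lemma cur_Hom:
  "\<lbrakk>f \<in> Hom C (a \<otimes> x) b; x \<in> Ob C; a \<in> Ob C; b \<in> Ob C\<rbrakk> \<Longrightarrow> Cur C a x b f \<in> Hom C x (IHom C a b)"
  using cur_bij[of x a b] by (auto simp: bij_betw_def)

lemma uncur_Hom:
  "\<lbrakk>\<phi> \<in> Hom C x (IHom C a b); a \<in> Ob C; b \<in> Ob C\<rbrakk> \<Longrightarrow> uncur C a x b \<phi> \<in> Hom C (a \<otimes> x) b"
  using cur_bij[of x a b] Hom_Ob[of \<phi> x "IHom C a b"] unfolding uncur_def bij_betw_def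
  by (metis inv_into_into)

lemma cur_uncur:
  "\<lbrakk>\<phi> \<in> Hom C x (IHom C a b); a \<in> Ob C; b \<in> Ob C\<rbrakk> \<Longrightarrow> Cur C a x b (uncur C a x b \<phi>) = \<phi>"
  using cur_bij[of x a b] Hom_Ob[of \<phi> x "IHom C a b"] unfolding uncur_def bij_betw_def
  by (metis f_inv_into_f)

lemma uncur_cur:
  "\<lbrakk>f \<in> Hom C (a \<otimes> x) b; x \<in> Ob C; a \<in> Ob C; b \<in> Ob C\<rbrakk> \<Longrightarrow> uncur C a x b (Cur C a x b f) = f"
  using cur_bij[of x a b] unfolding uncur_def bij_betw_def by (metis inv_into_f_f)

lemma uncur_natural:
  assumes "\<phi> \<in> Hom C x (IHom C a b)" "k \<in> Hom C x' x" "a \<in> Ob C" "b \<in> Ob C"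
  shows "uncur C a x' b (\<phi> \<cdot> k) = uncur C a x b \<phi> \<cdot> (\<one> a \<boxtimes> k)"
proof -
  have x: "x' \<in> Ob C" using Hom_Ob[OF assms(2)] by simp
  have u: "uncur C a x b \<phi> \<in> Hom C (a \<otimes> x) b" using assms uncur_Hom by simp
  then have "uncur C a x b \<phi> \<cdot> (\<one> a \<boxtimes> k) \<in> Hom C (a \<otimes> x') b"
    using assms(2-4) by (auto simp: in_Hom_iff)
  then show ?thesis
    using uncur_cur[of "uncur C a x b \<phi> \<cdot> (\<one> a \<boxtimes> k)" a x' b] cur_natural[OF assms(3) u assms(2)]
      cur_uncur[OF assms(1,3,4)] x assms(3,4) by simp
qed

lemma eval_Hom: "\<lbrakk>a \<in> Ob C; b \<in> Ob C\<rbrakk> \<Longrightarrow> eval_arrow C a b \<in> Hom C (a \<otimes> IHom C a b) b"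
  unfolding eval_arrow_def by (rule uncur_Hom) (simp_all add: id_Hom)

lemma eval_arr [simp]:
  assumes "a \<in> Ob C" "b \<in> Ob C"
  shows "eval_arrow C a b \<in> Arr C" "Dom C (eval_arrow C a b) = a \<otimes> IHom C a b"
    "Cod C (eval_arrow C a b) = b"
  using eval_Hom[OF assms] by (auto simp: in_Hom_iff)

lemma eval_comp:
  assumes "\<phi> \<in> Hom C x (IHom C a b)" "a \<in> Ob C" "b \<in> Ob C"
  shows "eval_arrow C a b \<cdot> (\<one> a \<boxtimes> \<phi>) = uncur C a x b \<phi>"
  unfolding eval_arrow_def
  using uncur_natural[of "\<one> (IHom C a b)" "IHom C a b" a b \<phi> x] assms
  by (simp add: id_Hom) (simp add: in_Hom_iff)

lemma left_transpose_Hom: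
  assumes "\<phi> \<in> Hom C x (IHom C a b)" "a \<in> Ob C" "b \<in> Ob C"
  shows "left_transpose C x a b \<phi> \<in> Hom C (x \<otimes> a) b"
  using uncur_Hom[OF assms] Hom_Ob[OF assms(1)] assms(2,3)
  by (auto simp: left_transpose_def in_Hom_iff)

lemma left_transpose_cur:
  assumes "f \<in> Hom C (x \<otimes> a) b" "x \<in> Ob C" "a \<in> Ob C"
  shows "left_transpose C x a b (Cur C a x b (f \<cdot> Sym C a x)) = f"
proof -
  have "uncur C a x b (Cur C a x b (f \<cdot> Sym C a x)) = f \<cdot> Sym C a x"
    using assms Hom_Ob[OF assms(1)] by (intro uncur_cur) (auto simp: in_Hom_iff)
  then show ?thesis using assms by (auto simp: left_transpose_def in_Hom_iff assoc)
qed

lemma cur_left_transpose: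
  assumes "\<phi> \<in> Hom C x (IHom C a b)" "a \<in> Ob C" "b \<in> Ob C"
  shows "Cur C a x b (left_transpose C x a b \<phi> \<cdot> Sym C a x) = \<phi>"
proof -
  have "left_transpose C x a b \<phi> \<cdot> Sym C a x = uncur C a x b \<phi>"
    using uncur_Hom[OF assms] Hom_Ob[OF assms(1)] assms(2,3)
    by (auto simp: left_transpose_def in_Hom_iff assoc)
  then show ?thesis using cur_uncur[OF assms] by simp
qed

lemma left_transpose_inject:
  assumes "\<phi> \<in> Hom C x (IHom C a b)" "\<psi> \<in> Hom C x (IHom C a b)" "a \<in> Ob C" "b \<in> Ob C"
  shows "left_transpose C x a b \<phi> = left_transpose C x a b \<psi> \<longleftrightarrow> \<phi> = \<psi>"
  using assms cur_left_transpose by metis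

lemma left_transpose_natural:
  assumes "\<phi> \<in> Hom C x (IHom C a b)" "k \<in> Hom C x' x" "a \<in> Ob C" "b \<in> Ob C"
  shows "left_transpose C x' a b (\<phi> \<cdot> k) = left_transpose C x a b \<phi> \<cdot> (k \<boxtimes> \<one> a)"
proof -
  have [simp]: "x' \<in> Ob C" "x \<in> Ob C" and k: "k \<in> Arr C" "Dom C k = x'" "Cod C k = x"
    using assms(2) by (auto simp: in_Hom_iff)
  have u: "uncur C a x b \<phi> \<in> Arr C" "Dom C (uncur C a x b \<phi>) = a \<otimes> x"
    using uncur_Hom[OF assms(1,3,4)] by (auto simp: in_Hom_iff)
  have "Sym C x a \<cdot> (k \<boxtimes> \<one> a) = (\<one> a \<boxtimes> k) \<cdot> Sym C x' a"
    using k assms(3) by (intro sym_nat) simp_all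
  then show ?thesis
    using k u assms(3) unfolding left_transpose_def uncur_natural[OF assms] by (simp add: assoc)
qed

lemma icomp_body_Hom:
  assumes "a \<in> Ob C" "b \<in> Ob C" "c \<in> Ob C"
  shows "eval_arrow C b c \<cdot> (eval_arrow C a b \<boxtimes> \<one> (IHom C b c))
      \<cdot> inv_arrow C (Asc C a (IHom C a b) (IHom C b c)) \<cdot> (\<one> a \<boxtimes> Sym C (IHom C b c) (IHom C a b))
    \<in> Hom C (a \<otimes> (IHom C b c \<otimes> IHom C a b)) c"
  using assms by (simp add: in_Hom_iff)

lemma icomp_Hom:
  assumes "a \<in> Ob C" "b \<in> Ob C" "c \<in> Ob C"
  shows "icomp C a b c \<in> Hom C (IHom C b c \<otimes> IHom C a b) (IHom C a c)"
  unfolding icomp_def using assms by (intro cur_Hom icomp_body_Hom) simp_all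

lemma icomp_arr [simp]:
  assumes "a \<in> Ob C" "b \<in> Ob C" "c \<in> Ob C"
  shows "icomp C a b c \<in> Arr C" "Dom C (icomp C a b c) = IHom C b c \<otimes> IHom C a b"
    "Cod C (icomp C a b c) = IHom C a c"
  using icomp_Hom[OF assms] by (auto simp: in_Hom_iff)

text \<open>Under transposition, internal composition becomes iterated action.  The order of the
  two arguments of \<open>icomp\<close> is reversed by the symmetry in its definition, and \<open>sym_reverse\<close> removes it again.\<close>

lemma left_transpose_icomp:
  assumes phi: "\<phi> \<in> Hom C x (IHom C b c)" and psi: "\<psi> \<in> Hom C y (IHom C a b)"
    and [simp]: "a \<in> Ob C" "b \<in> Ob C" "c \<in> Ob C"
  shows "left_transpose C (x \<otimes> y) a c (icomp C a b c \<cdot> (\<phi> \<boxtimes> \<psi>)) =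
    left_transpose C x b c \<phi> \<cdot> (\<one> x \<boxtimes> left_transpose C y a b \<psi>) \<cdot> Asc C x y a"
proof -
  let ?U = "uncur C b x c \<phi>" and ?V = "uncur C a y b \<psi>"
  let ?P = "IHom C b c" and ?Q = "IHom C a b"
  have [simp]: "\<phi> \<in> Arr C" "Dom C \<phi> = x" "Cod C \<phi> = ?P" "x \<in> Ob C"
      "\<psi> \<in> Arr C" "Dom C \<psi> = y" "Cod C \<psi> = ?Q" "y \<in> Ob C"
    using phi psi by (auto simp: in_Hom_iff)
  have [simp]: "?U \<in> Arr C" "Dom C ?U = b \<otimes> x" "Cod C ?U = c"
      "?V \<in> Arr C" "Dom C ?V = a \<otimes> y" "Cod C ?V = b"
    using uncur_Hom[OF phi] uncur_Hom[OF psi] by (auto simp: in_Hom_iff)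
  have "uncur C a (x \<otimes> y) c (icomp C a b c \<cdot> (\<phi> \<boxtimes> \<psi>))
      = uncur C a (?P \<otimes> ?Q) c (icomp C a b c) \<cdot> (\<one> a \<boxtimes> (\<phi> \<boxtimes> \<psi>))"
    by (rule uncur_natural[OF icomp_Hom]) (simp_all add: in_Hom_iff)
  also have "\<dots> = (eval_arrow C b c \<cdot> (eval_arrow C a b \<boxtimes> \<one> ?P)
      \<cdot> inv_arrow C (Asc C a ?Q ?P) \<cdot> (\<one> a \<boxtimes> Sym C ?P ?Q)) \<cdot> (\<one> a \<boxtimes> (\<phi> \<boxtimes> \<psi>))"
    unfolding icomp_def by (simp only: uncur_cur[OF icomp_body_Hom] assms ihom_Ob tensor_Ob)
  also have "\<dots> = eval_arrow C b c \<cdot> (eval_arrow C a b \<boxtimes> \<one> ?P)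
      \<cdot> inv_arrow C (Asc C a ?Q ?P) \<cdot> (\<one> a \<boxtimes> (\<psi> \<boxtimes> \<phi>)) \<cdot> (\<one> a \<boxtimes> Sym C x y)"
    by (simp add: assoc tensor_comp sym_nat)
  also have "\<dots> = eval_arrow C b c \<cdot> (eval_arrow C a b \<boxtimes> \<one> ?P)
      \<cdot> ((\<one> a \<boxtimes> \<psi>) \<boxtimes> \<phi>) \<cdot> inv_arrow C (Asc C a y x) \<cdot> (\<one> a \<boxtimes> Sym C x y)"
    using comp_eq_extend[OF assoc_inv_nat[of "\<one> a" \<psi> \<phi>], of "\<one> a \<boxtimes> Sym C x y"]
    by (simp add: assoc)
  also have "\<dots> = eval_arrow C b c \<cdot> (?V \<boxtimes> \<phi>) \<cdot> inv_arrow C (Asc C a y x) \<cdot> (\<one> a \<boxtimes> Sym C x y)"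
    using eval_comp[OF psi] by (simp add: tensor_comp_extend)
  also have "\<dots> = eval_arrow C b c \<cdot> (\<one> b \<boxtimes> \<phi>) \<cdot> (?V \<boxtimes> \<one> x)
      \<cdot> inv_arrow C (Asc C a y x) \<cdot> (\<one> a \<boxtimes> Sym C x y)"
    by (simp add: tensor_comp_extend)
  also have "\<dots> = ?U \<cdot> (?V \<boxtimes> \<one> x) \<cdot> inv_arrow C (Asc C a y x) \<cdot> (\<one> a \<boxtimes> Sym C x y)"
    by (rule comp_eq_extend[OF eval_comp[OF phi]]) simp_all
  finally have "left_transpose C (x \<otimes> y) a c (icomp C a b c \<cdot> (\<phi> \<boxtimes> \<psi>))
      = ?U \<cdot> (?V \<boxtimes> \<one> x) \<cdot> inv_arrow C (Asc C a y x) \<cdot> (\<one> a \<boxtimes> Sym C x y) \<cdot> Sym C (x \<otimes> y) a"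
    by (simp add: left_transpose_def assoc)
  also have "\<dots> = ?U \<cdot> (?V \<boxtimes> \<one> x) \<cdot> Sym C x (a \<otimes> y) \<cdot> (\<one> x \<boxtimes> Sym C y a) \<cdot> Asc C x y a"
    by (simp add: sym_reverse)
  also have "\<dots> = ?U \<cdot> Sym C x b \<cdot> (\<one> x \<boxtimes> ?V) \<cdot> (\<one> x \<boxtimes> Sym C y a) \<cdot> Asc C x y a"
  proof -
    have "Sym C x b \<cdot> (\<one> x \<boxtimes> ?V) = (?V \<boxtimes> \<one> x) \<cdot> Sym C x (a \<otimes> y)"
      by (rule sym_nat) simp_all
    then have "Sym C x b \<cdot> (\<one> x \<boxtimes> ?V) \<cdot> (\<one> x \<boxtimes> Sym C y a) \<cdot> Asc C x y a
        = ((?V \<boxtimes> \<one> x) \<cdot> Sym C x (a \<otimes> y)) \<cdot> (\<one> x \<boxtimes> Sym C y a) \<cdot> Asc C x y a"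
      by (rule comp_eq_extend) simp_all
    then show ?thesis by (simp add: assoc)
  qed
  also have "\<dots> = left_transpose C x b c \<phi> \<cdot> (\<one> x \<boxtimes> left_transpose C y a b \<psi>) \<cdot> Asc C x y a"
    by (simp add: left_transpose_def assoc tensor_comp_extend)
  finally show ?thesis .
qed

subsection \<open>Arrows as global elements of the internal hom\<close>

lemma sharp_Hom:
  assumes "h \<in> Hom C a b"
  shows "sharp C a b h \<in> Hom C \<I> (IHom C a b)"
  unfolding sharp_def using assms by (intro cur_Hom) (auto simp: in_Hom_iff)

lemma unsharp_Hom:
  assumes "k \<in> Hom C \<I> (IHom C a b)" "a \<in> Ob C" "b \<in> Ob C"
  shows "unsharp C a b k \<in> Hom C a b"
  unfolding unsharp_def using uncur_Hom[OF assms] assms(2,3) by (auto simp: in_Hom_iff)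

lemma sharp_unsharp:
  assumes "k \<in> Hom C \<I> (IHom C a b)" "a \<in> Ob C" "b \<in> Ob C"
  shows "sharp C a b (unsharp C a b k) = k"
proof -
  have "unsharp C a b k \<cdot> Run C a = uncur C a \<I> b k"
    using uncur_Hom[OF assms] assms(2,3) by (auto simp: unsharp_def in_Hom_iff assoc)
  then show ?thesis by (simp add: sharp_def cur_uncur[OF assms])
qed

lemma unsharp_sharp:
  assumes "h \<in> Hom C a b"
  shows "unsharp C a b (sharp C a b h) = h"
proof -
  have "uncur C a \<I> b (sharp C a b h) = h \<cdot> Run C a"
    unfolding sharp_def using assms by (intro uncur_cur) (auto simp: in_Hom_iff)
  then show ?thesis using assms by (auto simp: unsharp_def in_Hom_iff assoc)
qed

lemma left_transpose_sharp:
  assumes "h \<in> Hom C a b"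
  shows "left_transpose C \<I> a b (sharp C a b h) = h \<cdot> Lun C a"
proof -
  have "uncur C a \<I> b (sharp C a b h) = h \<cdot> Run C a"
    unfolding sharp_def using assms by (intro uncur_cur) (auto simp: in_Hom_iff)
  then show ?thesis using assms by (auto simp: left_transpose_def in_Hom_iff assoc runit_sym)
qed

lemma iident_Hom: "a \<in> Ob C \<Longrightarrow> iident C a \<in> Hom C \<I> (IHom C a a)"
  unfolding iident_def by (intro sharp_Hom id_Hom)

lemma left_transpose_iident: "a \<in> Ob C \<Longrightarrow> left_transpose C \<I> a a (iident C a) = Lun C a"
  unfolding iident_def by (simp add: left_transpose_sharp id_Hom)

lemma unsharp_iident: "a \<in> Ob C \<Longrightarrow> unsharp C a a (iident C a) = \<one> a"
  unfolding iident_def by (simp add: unsharp_sharp id_Hom)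

text \<open>The two sides of the naturality square of an enriched transformation with component
  \<open>h\<^sup>\<sharp>\<close>, transposed.  This lemma needs the triangle, the next one Kelly's coherence.\<close>

lemma left_transpose_icomp_sharp_right:
  assumes phi: "\<phi> \<in> Hom C x (IHom C b c)" and h: "h \<in> Hom C a b" and [simp]: "c \<in> Ob C"
  shows "left_transpose C x a c (icomp C a b c \<cdot> (\<phi> \<boxtimes> sharp C a b h) \<cdot> inv_arrow C (Run C x)) =
    left_transpose C x b c \<phi> \<cdot> (\<one> x \<boxtimes> h)"
proof -
  have [simp]: "h \<in> Arr C" "Dom C h = a" "Cod C h = b" "a \<in> Ob C" "b \<in> Ob C"
    "\<phi> \<in> Arr C" "Dom C \<phi> = x" "Cod C \<phi> = IHom C b c" "x \<in> Ob C"
    using h phi by (auto simp: in_Hom_iff)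
  have [simp]: "sharp C a b h \<in> Arr C" "Dom C (sharp C a b h) = \<I>" "Cod C (sharp C a b h) = IHom C a b"
    using sharp_Hom[OF h] by (auto simp: in_Hom_iff)
  have [simp]: "left_transpose C x b c \<phi> \<in> Arr C" "Dom C (left_transpose C x b c \<phi>) = x \<otimes> b"
    using left_transpose_Hom[OF phi] by (auto simp: in_Hom_iff)
  have "left_transpose C x a c (icomp C a b c \<cdot> (\<phi> \<boxtimes> sharp C a b h) \<cdot> inv_arrow C (Run C x))
      = left_transpose C x a c ((icomp C a b c \<cdot> (\<phi> \<boxtimes> sharp C a b h)) \<cdot> inv_arrow C (Run C x))"
    by (simp add: assoc)
  also have "\<dots> = left_transpose C (x \<otimes> \<I>) a c (icomp C a b c \<cdot> (\<phi> \<boxtimes> sharp C a b h))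
      \<cdot> (inv_arrow C (Run C x) \<boxtimes> \<one> a)"
    by (rule left_transpose_natural) (simp_all add: in_Hom_iff)
  also have "\<dots> = (left_transpose C x b c \<phi> \<cdot> (\<one> x \<boxtimes> (h \<cdot> Lun C a)) \<cdot> Asc C x \<I> a)
      \<cdot> (inv_arrow C (Run C x) \<boxtimes> \<one> a)"
    using left_transpose_icomp[OF phi sharp_Hom[OF h]] by (simp add: left_transpose_sharp[OF h])
  also have "\<dots> = left_transpose C x b c \<phi> \<cdot> (\<one> x \<boxtimes> h)
      \<cdot> ((\<one> x \<boxtimes> Lun C a) \<cdot> Asc C x \<I> a) \<cdot> (inv_arrow C (Run C x) \<boxtimes> \<one> a)"
    by (simp add: assoc tensor_comp_extend)
  also have "\<dots> = left_transpose C x b c \<phi> \<cdot> (\<one> x \<boxtimes> h)"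
    by (simp add: triangle tensor_comp tensor_id)
  finally show ?thesis .
qed

lemma left_transpose_icomp_sharp_left:
  assumes psi: "\<psi> \<in> Hom C x (IHom C a b)" and h: "h \<in> Hom C b c" and [simp]: "a \<in> Ob C"
  shows "left_transpose C x a c (icomp C a b c \<cdot> (sharp C b c h \<boxtimes> \<psi>) \<cdot> inv_arrow C (Lun C x)) =
    h \<cdot> left_transpose C x a b \<psi>"
proof -
  let ?V = "left_transpose C x a b \<psi>"
  have [simp]: "h \<in> Arr C" "Dom C h = b" "Cod C h = c" "b \<in> Ob C" "c \<in> Ob C"
    "\<psi> \<in> Arr C" "Dom C \<psi> = x" "Cod C \<psi> = IHom C a b" "x \<in> Ob C"
    using h psi by (auto simp: in_Hom_iff)
  have [simp]: "sharp C b c h \<in> Arr C" "Dom C (sharp C b c h) = \<I>" "Cod C (sharp C b c h) = IHom C b c"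
    using sharp_Hom[OF h] by (auto simp: in_Hom_iff)
  have [simp]: "?V \<in> Arr C" "Dom C ?V = x \<otimes> a" "Cod C ?V = b"
    using left_transpose_Hom[OF psi] by (auto simp: in_Hom_iff)
  have "left_transpose C x a c (icomp C a b c \<cdot> (sharp C b c h \<boxtimes> \<psi>) \<cdot> inv_arrow C (Lun C x))
      = left_transpose C x a c ((icomp C a b c \<cdot> (sharp C b c h \<boxtimes> \<psi>)) \<cdot> inv_arrow C (Lun C x))"
    by (simp add: assoc)
  also have "\<dots> = left_transpose C (\<I> \<otimes> x) a c (icomp C a b c \<cdot> (sharp C b c h \<boxtimes> \<psi>))
      \<cdot> (inv_arrow C (Lun C x) \<boxtimes> \<one> a)"
    by (rule left_transpose_natural) (simp_all add: in_Hom_iff)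
  also have "\<dots> = ((h \<cdot> Lun C b) \<cdot> (\<one> \<I> \<boxtimes> ?V) \<cdot> Asc C \<I> x a) \<cdot> (inv_arrow C (Lun C x) \<boxtimes> \<one> a)"
    using left_transpose_icomp[OF sharp_Hom[OF h] psi] by (simp add: left_transpose_sharp[OF h])
  also have "\<dots> = h \<cdot> (Lun C b \<cdot> (\<one> \<I> \<boxtimes> ?V)) \<cdot> Asc C \<I> x a \<cdot> (inv_arrow C (Lun C x) \<boxtimes> \<one> a)"
    by (simp add: assoc)
  also have "\<dots> = h \<cdot> ?V \<cdot> (Lun C (x \<otimes> a) \<cdot> Asc C \<I> x a) \<cdot> (inv_arrow C (Lun C x) \<boxtimes> \<one> a)"
    by (simp add: lunit_nat assoc)
  also have "\<dots> = h \<cdot> ?V"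
    by (simp add: lunit_tensor tensor_comp tensor_id)
  finally show ?thesis .
qed

text \<open>The composite of two enriched transformations on components.  Both sides transpose to
  \<open>k \<cdot> h \<cdot> Lun C a\<close>.\<close>

lemma sharp_comp:
  assumes h: "h \<in> Hom C a b" and k: "k \<in> Hom C b c"
  shows "sharp C a c (k \<cdot> h) = icomp C a b c \<cdot> (sharp C b c k \<boxtimes> sharp C a b h) \<cdot> inv_arrow C (Lun C \<I>)"
proof -
  have [simp]: "h \<in> Arr C" "Dom C h = a" "Cod C h = b" "a \<in> Ob C" "b \<in> Ob C"
    "k \<in> Arr C" "Dom C k = b" "Cod C k = c" "c \<in> Ob C"
    using h k by (auto simp: in_Hom_iff)
  have [simp]: "sharp C a b h \<in> Arr C" "Dom C (sharp C a b h) = \<I>" "Cod C (sharp C a b h) = IHom C a b"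
    "sharp C b c k \<in> Arr C" "Dom C (sharp C b c k) = \<I>" "Cod C (sharp C b c k) = IHom C b c"
    using sharp_Hom[OF h] sharp_Hom[OF k] by (auto simp: in_Hom_iff)
  have "left_transpose C \<I> a c (sharp C a c (k \<cdot> h)) =
      left_transpose C \<I> a c
        (icomp C a b c \<cdot> (sharp C b c k \<boxtimes> sharp C a b h) \<cdot> inv_arrow C (Lun C \<I>))"
    using left_transpose_sharp[of "k \<cdot> h" a c] comp_Hom[OF h k]
      left_transpose_icomp_sharp_left[OF sharp_Hom[OF h] k] left_transpose_sharp[OF h]
    by (simp add: assoc)
  then show ?thesis
    by (subst (asm) left_transpose_inject) (use sharp_Hom[OF comp_Hom[OF h k]] in \<open>simp_all add: in_Hom_iff\<close>)
qed

end

section \<open>Transporting category structure along faithful functors\<close>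

text \<open>Structure that is mapped faithfully to a category, respecting sources, targets, identities
  and composition, is itself a category: the axioms are equations between parallel arrows.\<close>

lemma faithful_functorI:
  fixes C :: "('o, 'a, 'm) cat_scheme" and D :: "('p, 'b, 'n) cat_scheme"
  assumes D: "category D"
    and ends: "\<And>f. f \<in> Arr C \<Longrightarrow> Dom C f \<in> Ob C \<and> Cod C f \<in> Ob C"
    and obj: "\<And>a. a \<in> Ob C \<Longrightarrow> FOb F a \<in> Ob D"
    and arr: "\<And>a b f. f \<in> Hom C a b \<Longrightarrow> FArr F f \<in> Hom D (FOb F a) (FOb F b)"
    and faithful: "\<And>a b f g. \<lbrakk>f \<in> Hom C a b; g \<in> Hom C a b; FArr F f = FArr F g\<rbrakk> \<Longrightarrow> f = g"
    and ident: "\<And>a. a \<in> Ob C \<Longrightarrow>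
      \<one>\<^bsub>C\<^esub> a \<in> Hom C a a \<and> FArr F (\<one>\<^bsub>C\<^esub> a) = \<one>\<^bsub>D\<^esub> (FOb F a)"
    and comp: "\<And>a b c f g. \<lbrakk>f \<in> Hom C a b; g \<in> Hom C b c\<rbrakk> \<Longrightarrow>
      g \<cdot>\<^bsub>C\<^esub> f \<in> Hom C a c \<and> FArr F (g \<cdot>\<^bsub>C\<^esub> f) = FArr F g \<cdot>\<^bsub>D\<^esub> FArr F f"
  shows "cat_functor C D F"
proof -
  interpret D: category D by (rule D)
  have ob: "a \<in> Ob C \<and> b \<in> Ob C" if "f \<in> Hom C a b" for a b f
    using that ends by (auto simp: Hom_def)
  have "category C"
  proof
    fix f a b assume f: "f \<in> Hom C a b"
    have i: "\<one>\<^bsub>C\<^esub> a \<in> Hom C a a" "\<one>\<^bsub>C\<^esub> b \<in> Hom C b b" using ob[OF f] ident by auto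
    show "f \<cdot>\<^bsub>C\<^esub> \<one>\<^bsub>C\<^esub> a = f"
      using comp[OF i(1) f] ob[OF f] ident D.comp_id_right[OF arr[OF f]] f
      by (intro faithful[of _ a b]) auto
    show "\<one>\<^bsub>C\<^esub> b \<cdot>\<^bsub>C\<^esub> f = f"
      using comp[OF f i(2)] ob[OF f] ident D.comp_id_left[OF arr[OF f]] f
      by (intro faithful[of _ a b]) auto
  next
    fix f g h a b c d
    assume f: "f \<in> Hom C a b" and g: "g \<in> Hom C b c" and h: "h \<in> Hom C c d"
    show "(h \<cdot>\<^bsub>C\<^esub> g) \<cdot>\<^bsub>C\<^esub> f = h \<cdot>\<^bsub>C\<^esub> g \<cdot>\<^bsub>C\<^esub> f"
      using comp[OF f g] comp[OF g h] comp[OF f, of "h \<cdot>\<^bsub>C\<^esub> g" d]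
        comp[of "g \<cdot>\<^bsub>C\<^esub> f" a c h d] h D.comp_assoc[OF arr[OF f] arr[OF g] arr[OF h]]
      by (intro faithful[of _ a d]) auto
  qed (use ends ident comp in auto)
  then show ?thesis
    unfolding cat_functor_def using D obj arr ident comp by auto
qed

text \<open>A two-sided inverse of a functor is a functor as soon as it respects sources and targets.\<close>

lemma inverse_functorsI:
  fixes C :: "('o, 'a, 'm) cat_scheme" and D :: "('p, 'b, 'n) cat_scheme"
  assumes F: "cat_functor C D F"
    and G_obj: "\<And>b. b \<in> Ob D \<Longrightarrow> FOb G b \<in> Ob C \<and> FOb F (FOb G b) = b"
    and GF_obj: "\<And>a. a \<in> Ob C \<Longrightarrow> FOb G (FOb F a) = a"
    and G_arr: "\<And>a b g. g \<in> Hom D a b \<Longrightarrow>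
      FArr G g \<in> Hom C (FOb G a) (FOb G b) \<and> FArr F (FArr G g) = g"
    and GF_arr: "\<And>f. f \<in> Arr C \<Longrightarrow> FArr G (FArr F f) = f"
  shows "inverse_functors C D F G"
proof -
  interpret C: category C using F by (simp add: cat_functor_def)
  interpret D: category D using F by (simp add: cat_functor_def)
  have F_id: "FArr F (\<one>\<^bsub>C\<^esub> a) = \<one>\<^bsub>D\<^esub> (FOb F a)" if "a \<in> Ob C" for a
    using F that by (auto simp: cat_functor_def)
  have F_comp: "FArr F (g \<cdot>\<^bsub>C\<^esub> f) = FArr F g \<cdot>\<^bsub>D\<^esub> FArr F f"
    if "f \<in> Hom C a b" "g \<in> Hom C b c" for a b c f g
    using F that C.Hom_Ob[OF that(1)] C.Hom_Ob[OF that(2)] unfolding cat_functor_def by blast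
  have "FArr G (\<one>\<^bsub>D\<^esub> a) = \<one>\<^bsub>C\<^esub> (FOb G a)" if "a \<in> Ob D" for a
    using GF_arr[of "\<one>\<^bsub>C\<^esub> (FOb G a)"] F_id[of "FOb G a"] G_obj[OF that] by simp
  moreover have "FArr G (g \<cdot>\<^bsub>D\<^esub> f) = FArr G g \<cdot>\<^bsub>C\<^esub> FArr G f"
    if "f \<in> Hom D a b" "g \<in> Hom D b c" for a b c f g
  proof -
    note f = G_arr[OF that(1)] and g = G_arr[OF that(2)]
    have "FArr G g \<cdot>\<^bsub>C\<^esub> FArr G f \<in> Arr C"
      using C.comp_Hom[OF conjunct1[OF f] conjunct1[OF g]] by (simp add: C.in_Hom_iff)
    then show ?thesis
      using GF_arr[of "FArr G g \<cdot>\<^bsub>C\<^esub> FArr G f"] F_comp[OF conjunct1[OF f] conjunct1[OF g]] f g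
      by simp
  qed
  ultimately have "cat_functor D C G"
    unfolding cat_functor_def using C.category_axioms D.category_axioms G_obj G_arr by auto
  moreover have "FArr F (FArr G g) = g" if "g \<in> Arr D" for g
    using G_arr[of g "Dom D g" "Cod D g"] that by (simp add: D.in_Hom_iff)
  ultimately show ?thesis
    unfolding inverse_functors_def functor_eq_on_def comp_functor_def id_functor_def
    using F G_obj GF_obj GF_arr by simp
qed

lemma cat_functor_comp:
  assumes F: "cat_functor C D F" and G: "cat_functor D E G"
  shows "cat_functor C E (comp_functor G F)"
proof -
  have F': "FOb F a \<in> Ob D" "FArr F (\<one>\<^bsub>C\<^esub> a) = \<one>\<^bsub>D\<^esub> (FOb F a)" if "a \<in> Ob C" for a
    using F that by (auto simp: cat_functor_def)
  have F'': "FArr F f \<in> Hom D (FOb F a) (FOb F b)" if "a \<in> Ob C" "b \<in> Ob C" "f \<in> Hom C a b" for a b f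
    using F that by (auto simp: cat_functor_def)
  have FG: "FArr F (g \<cdot>\<^bsub>C\<^esub> f) = FArr F g \<cdot>\<^bsub>D\<^esub> FArr F f"
    if "a \<in> Ob C" "b \<in> Ob C" "c \<in> Ob C" "f \<in> Hom C a b" "g \<in> Hom C b c" for a b c f g
    using F that unfolding cat_functor_def by blast
  have G': "FArr G (g \<cdot>\<^bsub>D\<^esub> f) = FArr G g \<cdot>\<^bsub>E\<^esub> FArr G f"
    if "a \<in> Ob D" "b \<in> Ob D" "c \<in> Ob D" "f \<in> Hom D a b" "g \<in> Hom D b c" for a b c f g
    using G that unfolding cat_functor_def by blast
  have "FArr G (FArr F (g \<cdot>\<^bsub>C\<^esub> f)) = FArr G (FArr F g) \<cdot>\<^bsub>E\<^esub> FArr G (FArr F f)"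
    if "a \<in> Ob C" "b \<in> Ob C" "c \<in> Ob C" "f \<in> Hom C a b" "g \<in> Hom C b c" for a b c f g
    using FG[OF that] G'[OF F'(1)[OF that(1)] F'(1)[OF that(2)] F'(1)[OF that(3)]
        F''[OF that(1,2,4)] F''[OF that(2,3,5)]] by simp
  then show ?thesis
    using F G F' F'' unfolding cat_functor_def comp_functor_def by simp
qed

lemma inverse_functors_comp:
  assumes FG: "inverse_functors C D F G" and FG': "inverse_functors D E F' G'"
  shows "inverse_functors C E (comp_functor F' F) (comp_functor G G')"
proof -
  have funs: "cat_functor C D F" "cat_functor D C G" "cat_functor D E F'" "cat_functor E D G'"
    using FG FG' by (auto simp: inverse_functors_def)
  have arr: "FArr H f \<in> Arr B" if "cat_functor A B H" "f \<in> Arr A"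
    for A :: "('x, 'y, 'z) cat_scheme" and B :: "('u, 'v, 'w) cat_scheme" and H f
  proof -
    interpret A: category A using that(1) by (simp add: cat_functor_def)
    have "f \<in> Hom A (Dom A f) (Cod A f)" using that(2) by (simp add: A.in_Hom_iff)
    then have "FArr H f \<in> Hom B (FOb H (Dom A f)) (FOb H (Cod A f))"
      using that unfolding cat_functor_def by (metis A.dom_in_Ob A.cod_in_Ob)
    then show ?thesis by (simp add: Hom_def)
  qed
  have obj: "FOb H a \<in> Ob B" if "cat_functor A B H" "a \<in> Ob A"
    for A :: "('x, 'y, 'z) cat_scheme" and B :: "('u, 'v, 'w) cat_scheme" and H a
    using that by (auto simp: cat_functor_def)
  show ?thesis
    using FG FG' funs cat_functor_comp[OF funs(1,3)] cat_functor_comp[OF funs(4,2)]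
      arr[OF funs(1)] arr[OF funs(4)] obj[OF funs(1)] obj[OF funs(4)]
    unfolding inverse_functors_def functor_eq_on_def comp_functor_def id_functor_def by simp
qed

lemma inverse_functors_bij_betw:
  assumes "inverse_functors C D F G"
  shows "bij_betw (FOb F) (Ob C) (Ob D)"
  using assms
  by (intro bij_betw_byWitness[where f' = "FOb G"])
    (auto simp: inverse_functors_def functor_eq_on_def comp_functor_def id_functor_def cat_functor_def)


section \<open>Left actions and parameterized endomorphisms\<close>

text \<open>An object \<open>T\<close> with arrows \<open>\<mu> : T \<otimes> T \<rightarrow> T\<close> and \<open>\<iota> : 1 \<rightarrow> T\<close>, subject to no laws.\<close>

locale acting_object = closed_symmetric_monoidal_category C
  for C :: "('o, 'a, 'm) csmcat_scheme" (structure) +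
  fixes T :: 'o and \<mu> \<iota> :: 'a
  assumes T_Ob [simp]: "T \<in> Ob C"
    and mult_Hom: "\<mu> \<in> Hom C (T \<otimes> T) T"
    and unit_Hom: "\<iota> \<in> Hom C \<I> T"
begin

lemma left_action_Hom:
  "left_action C T \<mu> \<iota> (\<Omega>, \<Psi>) \<Longrightarrow> \<Omega> \<in> Ob C \<and> \<Psi> \<in> Hom C (T \<otimes> \<Omega>) \<Omega>"
  by (simp add: left_action_def)

lemma in_Hom_left_action_cat:
  "(p, h, q) \<in> Hom (left_action_cat C T \<mu> \<iota>) p' q' \<longleftrightarrow>
    p = p' \<and> q = q' \<and> left_action C T \<mu> \<iota> p \<and> left_action C T \<mu> \<iota> q \<and>
    h \<in> Hom C (fst p) (fst q) \<and> h \<cdot> snd p = snd q \<cdot> (\<one> T \<boxtimes> h)"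
  by (cases p; cases q) (auto simp: left_action_cat_def Hom_def)

lemma left_action_cat_select [simp]:
  "Ob (left_action_cat C T \<mu> \<iota>) = {p. left_action C T \<mu> \<iota> p}"
  "\<one>\<^bsub>left_action_cat C T \<mu> \<iota>\<^esub> p = (p, \<one> (fst p), p)"
  "(q, k, r) \<cdot>\<^bsub>left_action_cat C T \<mu> \<iota>\<^esub> (p, h, q') = (p, k \<cdot> h, r)"
  "Dom (left_action_cat C T \<mu> \<iota>) (p, h, q) = p"
  "Cod (left_action_cat C T \<mu> \<iota>) (p, h, q) = q"
  by (simp_all add: left_action_cat_def)

lemma equivariant_comp:
  assumes "left_action C T \<mu> \<iota> (a, \<Psi>)" "left_action C T \<mu> \<iota> (b, \<Psi>')" "left_action C T \<mu> \<iota> (c, \<Psi>'')"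
    and h: "h \<in> Hom C a b" "h \<cdot> \<Psi> = \<Psi>' \<cdot> (\<one> T \<boxtimes> h)"
    and k: "k \<in> Hom C b c" "k \<cdot> \<Psi>' = \<Psi>'' \<cdot> (\<one> T \<boxtimes> k)"
  shows "(k \<cdot> h) \<cdot> \<Psi> = \<Psi>'' \<cdot> (\<one> T \<boxtimes> (k \<cdot> h))"
proof -
  have [simp]: "a \<in> Ob C" "b \<in> Ob C" "c \<in> Ob C" "\<Psi> \<in> Arr C" "Dom C \<Psi> = T \<otimes> a" "Cod C \<Psi> = a"
    "\<Psi>' \<in> Arr C" "Dom C \<Psi>' = T \<otimes> b" "Cod C \<Psi>' = b"
    "\<Psi>'' \<in> Arr C" "Dom C \<Psi>'' = T \<otimes> c" "Cod C \<Psi>'' = c"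
    "h \<in> Arr C" "Dom C h = a" "Cod C h = b" "k \<in> Arr C" "Dom C k = b" "Cod C k = c"
    using assms by (auto simp: in_Hom_iff dest!: left_action_Hom)
  have "(k \<cdot> h) \<cdot> \<Psi> = (k \<cdot> \<Psi>') \<cdot> (\<one> T \<boxtimes> h)"
    by (simp add: assoc h(2))
  also have "\<dots> = \<Psi>'' \<cdot> (\<one> T \<boxtimes> (k \<cdot> h))"
    by (simp add: k(2) assoc tensor_comp)
  finally show ?thesis .
qed

lemma category_left_action_cat: "category (left_action_cat C T \<mu> \<iota>)" (is "category ?L")
proof
  fix f assume "f \<in> Arr ?L"
  then show "Dom ?L f \<in> Ob ?L" "Cod ?L f \<in> Ob ?L"
    by (auto simp: left_action_cat_def)
next
  fix p assume "p \<in> Ob ?L"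
  then show "\<one>\<^bsub>?L\<^esub> p \<in> Hom ?L p p"
    by (cases p) (auto simp: in_Hom_left_action_cat in_Hom_iff tensor_id dest!: left_action_Hom)
next
  fix f g p q r assume f: "f \<in> Hom ?L p q" and g: "g \<in> Hom ?L q r"
  then show "g \<cdot>\<^bsub>?L\<^esub> f \<in> Hom ?L p r"
    by (cases f; cases g; cases p; cases q; cases r)
      (auto simp: in_Hom_left_action_cat intro: comp_Hom equivariant_comp)
next
  fix f p q assume "f \<in> Hom ?L p q"
  then show "f \<cdot>\<^bsub>?L\<^esub> \<one>\<^bsub>?L\<^esub> p = f" "\<one>\<^bsub>?L\<^esub> q \<cdot>\<^bsub>?L\<^esub> f = f"
    by (cases f; auto simp: in_Hom_left_action_cat in_Hom_iff)+
next
  fix f g h p q r t assume "f \<in> Hom ?L p q" "g \<in> Hom ?L q r" "h \<in> Hom ?L r t"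
  then show "(h \<cdot>\<^bsub>?L\<^esub> g) \<cdot>\<^bsub>?L\<^esub> f = h \<cdot>\<^bsub>?L\<^esub> g \<cdot>\<^bsub>?L\<^esub> f"
    by (cases f; cases g; cases h) (auto simp: in_Hom_left_action_cat in_Hom_iff assoc)
qed

lemma adjoint_action_eq: "adjoint_action C T (\<Omega>, \<phi>) = (\<Omega>, left_transpose C T \<Omega> \<Omega> \<phi>)"
  by (simp add: adjoint_action_def left_transpose_def)

lemma fst_adjoint [simp]:
  "fst (adjoint_action C T p) = fst p" "fst (adjoint_endo C T p) = fst p"
  by (simp_all add: adjoint_action_def adjoint_endo_def split: prod.split)

text \<open>The two equations for \<open>\<phi> : T \<rightarrow> [\<Omega>;\<Omega>]\<close> transpose one by one to the laws of a left action.\<close>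

lemma left_action_left_transpose_iff:
  assumes phi: "\<phi> \<in> Hom C T (IHom C \<Omega> \<Omega>)" and [simp]: "\<Omega> \<in> Ob C"
  shows "left_action C T \<mu> \<iota> (\<Omega>, left_transpose C T \<Omega> \<Omega> \<phi>) \<longleftrightarrow> param_endo C T \<mu> \<iota> (\<Omega>, \<phi>)"
proof -
  have "\<phi> \<cdot> \<iota> = iident C \<Omega> \<longleftrightarrow> left_transpose C T \<Omega> \<Omega> \<phi> \<cdot> (\<iota> \<boxtimes> \<one> \<Omega>) = Lun C \<Omega>"
    using left_transpose_inject[of "\<phi> \<cdot> \<iota>" \<I> \<Omega> \<Omega> "iident C \<Omega>"] comp_Hom[OF unit_Hom phi]
    by (simp add: iident_Hom left_transpose_natural[OF phi unit_Hom] left_transpose_iident)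
  moreover have "\<phi> \<cdot> \<mu> = icomp C \<Omega> \<Omega> \<Omega> \<cdot> (\<phi> \<boxtimes> \<phi>) \<longleftrightarrow>
      left_transpose C T \<Omega> \<Omega> \<phi> \<cdot> (\<mu> \<boxtimes> \<one> \<Omega>) =
      left_transpose C T \<Omega> \<Omega> \<phi> \<cdot> (\<one> T \<boxtimes> left_transpose C T \<Omega> \<Omega> \<phi>) \<cdot> Asc C T T \<Omega>"
    using left_transpose_inject[of "\<phi> \<cdot> \<mu>" "T \<otimes> T" \<Omega> \<Omega> "icomp C \<Omega> \<Omega> \<Omega> \<cdot> (\<phi> \<boxtimes> \<phi>)"]
      comp_Hom[OF mult_Hom phi] comp_Hom[OF tensor_Hom[OF phi phi] icomp_Hom]
    by (simp add: left_transpose_natural[OF phi mult_Hom] left_transpose_icomp[OF phi phi])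
  ultimately show ?thesis
    using phi left_transpose_Hom[OF phi] by (auto simp: left_action_def param_endo_def)
qed

lemma param_endo_Hom:
  "param_endo C T \<mu> \<iota> (\<Omega>, \<phi>) \<Longrightarrow> \<Omega> \<in> Ob C \<and> \<phi> \<in> Hom C T (IHom C \<Omega> \<Omega>)"
  by (simp add: param_endo_def)

lemma left_action_adjoint_action:
  "param_endo C T \<mu> \<iota> p \<Longrightarrow> left_action C T \<mu> \<iota> (adjoint_action C T p)"
  by (cases p) (metis adjoint_action_eq left_action_left_transpose_iff param_endo_Hom)

lemma adjoint_endo_adjoint_action:
  assumes "param_endo C T \<mu> \<iota> p"
  shows "adjoint_endo C T (adjoint_action C T p) = p"
  using assms
  by (cases p) (auto simp: adjoint_action_eq adjoint_endo_def cur_left_transpose dest!: param_endo_Hom)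

lemma adjoint_action_adjoint_endo:
  assumes "left_action C T \<mu> \<iota> p"
  shows "adjoint_action C T (adjoint_endo C T p) = p"
  using assms
  by (cases p) (auto simp: adjoint_action_eq adjoint_endo_def left_transpose_cur dest!: left_action_Hom)

lemma param_endo_adjoint_endo:
  assumes "left_action C T \<mu> \<iota> p"
  shows "param_endo C T \<mu> \<iota> (adjoint_endo C T p)"
proof (cases p)
  case (Pair \<Omega> \<Psi>)
  have p: "\<Omega> \<in> Ob C" "\<Psi> \<in> Hom C (T \<otimes> \<Omega>) \<Omega>"
    using assms Pair left_action_Hom by auto
  then have "Cur C \<Omega> T \<Omega> (\<Psi> \<cdot> Sym C \<Omega> T) \<in> Hom C T (IHom C \<Omega> \<Omega>)"
    by (intro cur_Hom) (auto simp: in_Hom_iff)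
  then show ?thesis
    using left_action_left_transpose_iff[of "Cur C \<Omega> T \<Omega> (\<Psi> \<cdot> Sym C \<Omega> T)" \<Omega>] p assms
    by (simp add: Pair adjoint_endo_def left_transpose_cur)
qed

lemma param_endo_cat_select [simp]:
  "Ob (param_endo_cat C T \<mu> \<iota>) = {p. param_endo C T \<mu> \<iota> p}"
  "\<one>\<^bsub>param_endo_cat C T \<mu> \<iota>\<^esub> p = (p, \<one> (fst p), p)"
  "(q, k, r) \<cdot>\<^bsub>param_endo_cat C T \<mu> \<iota>\<^esub> (p, h, q') = (p, k \<cdot> h, r)"
  "Dom (param_endo_cat C T \<mu> \<iota>) (p, h, q) = p"
  "Cod (param_endo_cat C T \<mu> \<iota>) (p, h, q) = q"
  by (simp_all add: param_endo_cat_def Let_def)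

lemma in_Hom_param_endo_cat:
  "(p, h, q) \<in> Hom (param_endo_cat C T \<mu> \<iota>) p' q' \<longleftrightarrow>
    p = p' \<and> q = q' \<and> param_endo C T \<mu> \<iota> p \<and> param_endo C T \<mu> \<iota> q \<and>
    (adjoint_action C T p, h, adjoint_action C T q)
      \<in> Hom (left_action_cat C T \<mu> \<iota>) (adjoint_action C T p) (adjoint_action C T q)"
  by (auto simp: param_endo_cat_def Let_def Hom_def)

lemma cat_functor_adjoint_action:
  "cat_functor (param_endo_cat C T \<mu> \<iota>) (left_action_cat C T \<mu> \<iota>) (adjoint_action_functor C T)"
  (is "cat_functor ?P ?L ?F")
proof (rule faithful_functorI)
  interpret L: category ?L by (rule category_left_action_cat)
  show "category ?L" by (rule category_left_action_cat)
  show "Dom ?P f \<in> Ob ?P \<and> Cod ?P f \<in> Ob ?P" if "f \<in> Arr ?P" for f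
    using that by (auto simp: param_endo_cat_def Let_def)
  show "FOb ?F p \<in> Ob ?L" if "p \<in> Ob ?P" for p
    using that by (simp add: adjoint_action_functor_def left_action_adjoint_action)
  show "FArr ?F f \<in> Hom ?L (FOb ?F p) (FOb ?F q)" if "f \<in> Hom ?P p q" for f p q
    using that by (cases f) (auto simp: in_Hom_param_endo_cat adjoint_action_functor_def)
  show "f = g" if "f \<in> Hom ?P p q" "g \<in> Hom ?P p q" "FArr ?F f = FArr ?F g" for f g p q
    using that by (cases f; cases g) (auto simp: in_Hom_param_endo_cat adjoint_action_functor_def)
  show "\<one>\<^bsub>?P\<^esub> p \<in> Hom ?P p p \<and> FArr ?F (\<one>\<^bsub>?P\<^esub> p) = \<one>\<^bsub>?L\<^esub> (FOb ?F p)" if "p \<in> Ob ?P" for p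
    using that L.id_Hom[of "adjoint_action C T p"] left_action_adjoint_action[of p]
    by (simp add: in_Hom_param_endo_cat adjoint_action_functor_def)
  show "g \<cdot>\<^bsub>?P\<^esub> f \<in> Hom ?P p r \<and> FArr ?F (g \<cdot>\<^bsub>?P\<^esub> f) = FArr ?F g \<cdot>\<^bsub>?L\<^esub> FArr ?F f"
    if fg: "f \<in> Hom ?P p q" "g \<in> Hom ?P q r" for f g p q r
  proof -
    obtain h k where "f = (p, h, q)" "g = (q, k, r)"
      using fg by (cases f; cases g) (auto simp: in_Hom_param_endo_cat)
    moreover from this have "(adjoint_action C T q, k, adjoint_action C T r)
        \<cdot>\<^bsub>?L\<^esub> (adjoint_action C T p, h, adjoint_action C T q)
        \<in> Hom ?L (adjoint_action C T p) (adjoint_action C T r)"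
      using fg by (intro L.comp_Hom) (auto simp: in_Hom_param_endo_cat)
    ultimately show ?thesis
      using fg by (simp add: in_Hom_param_endo_cat adjoint_action_functor_def)
  qed
qed

lemma inverse_functors_adjoint:
  "inverse_functors (param_endo_cat C T \<mu> \<iota>) (left_action_cat C T \<mu> \<iota>)
    (adjoint_action_functor C T) (adjoint_endo_functor C T)"
  (is "inverse_functors ?P ?L ?F ?G")
proof (rule inverse_functorsI[OF cat_functor_adjoint_action])
  show "FOb ?G p \<in> Ob ?P \<and> FOb ?F (FOb ?G p) = p" if "p \<in> Ob ?L" for p
    using that by (simp add: adjoint_action_functor_def adjoint_endo_functor_def
      param_endo_adjoint_endo adjoint_action_adjoint_endo)
  show "FOb ?G (FOb ?F p) = p" if "p \<in> Ob ?P" for p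
    using that by (simp add: adjoint_action_functor_def adjoint_endo_functor_def
      adjoint_endo_adjoint_action)
  show "FArr ?G f \<in> Hom ?P (FOb ?G p) (FOb ?G q) \<and> FArr ?F (FArr ?G f) = f" if "f \<in> Hom ?L p q" for f p q
  proof -
    obtain p' h q' where "f = (p', h, q')" by (rule prod_cases3)
    with that have f: "f = (p, h, q)" by (simp add: in_Hom_left_action_cat)
    then have "left_action C T \<mu> \<iota> p" "left_action C T \<mu> \<iota> q"
      using that by (auto simp: in_Hom_left_action_cat)
    then show ?thesis
      using that f by (simp add: adjoint_action_functor_def adjoint_endo_functor_def
        in_Hom_param_endo_cat param_endo_adjoint_endo adjoint_action_adjoint_endo)
  qed
  show "FArr ?G (FArr ?F f) = f" if "f \<in> Arr ?P" for f
    using that by (auto simp: param_endo_cat_def Let_def adjoint_action_functor_def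
      adjoint_endo_functor_def adjoint_endo_adjoint_action)
qed

text \<open>Equivariance of \<open>h\<close> is the naturality of \<open>h\<^sup>\<sharp>\<close>: the sides of the naturality square have
  transposes \<open>\<Psi>' \<cdot> (T \<otimes> h)\<close> and \<open>h \<cdot> \<Psi>\<close>.\<close>

lemma sharp_natural_iff_equivariant:
  assumes phi: "\<phi> \<in> Hom C T (IHom C a a)" and psi: "\<psi> \<in> Hom C T (IHom C b b)" and h: "h \<in> Hom C a b"
  shows "icomp C a b b \<cdot> (\<psi> \<boxtimes> sharp C a b h) \<cdot> inv_arrow C (Run C T) =
      icomp C a a b \<cdot> (sharp C a b h \<boxtimes> \<phi>) \<cdot> inv_arrow C (Lun C T) \<longleftrightarrow>
    h \<cdot> left_transpose C T a a \<phi> = left_transpose C T b b \<psi> \<cdot> (\<one> T \<boxtimes> h)"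
proof -
  have [simp]: "a \<in> Ob C" "b \<in> Ob C" using Hom_Ob[OF h] by auto
  have "icomp C a b b \<cdot> (\<psi> \<boxtimes> sharp C a b h) \<cdot> inv_arrow C (Run C T) \<in> Hom C T (IHom C a b)"
    "icomp C a a b \<cdot> (sharp C a b h \<boxtimes> \<phi>) \<cdot> inv_arrow C (Lun C T) \<in> Hom C T (IHom C a b)"
    using phi psi sharp_Hom[OF h] by (auto simp: in_Hom_iff)
  then show ?thesis
    using left_transpose_icomp_sharp_right[OF psi h] left_transpose_icomp_sharp_left[OF phi h]
      left_transpose_inject[of "icomp C a b b \<cdot> (\<psi> \<boxtimes> sharp C a b h) \<cdot> inv_arrow C (Run C T)" T a b]
    by fastforce
qed

lemma in_Hom_param_endo_cat_sharp:
  "((a, \<phi>), h, (b, \<psi>)) \<in> Hom (param_endo_cat C T \<mu> \<iota>) p q \<longleftrightarrow>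
    p = (a, \<phi>) \<and> q = (b, \<psi>) \<and> param_endo C T \<mu> \<iota> (a, \<phi>) \<and> param_endo C T \<mu> \<iota> (b, \<psi>) \<and> h \<in> Hom C a b \<and>
    icomp C a b b \<cdot> (\<psi> \<boxtimes> sharp C a b h) \<cdot> inv_arrow C (Run C T) =
      icomp C a a b \<cdot> (sharp C a b h \<boxtimes> \<phi>) \<cdot> inv_arrow C (Lun C T)"
proof (cases "param_endo C T \<mu> \<iota> (a, \<phi>) \<and> param_endo C T \<mu> \<iota> (b, \<psi>)")
  case True
  then have "\<phi> \<in> Hom C T (IHom C a a)" "\<psi> \<in> Hom C T (IHom C b b)"
    using param_endo_Hom by auto
  then show ?thesis
    using True left_action_adjoint_action[of "(a, \<phi>)"] left_action_adjoint_action[of "(b, \<psi>)"]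
    by (auto simp: in_Hom_param_endo_cat in_Hom_left_action_cat adjoint_action_eq
        sharp_natural_iff_equivariant)
qed (auto simp: in_Hom_param_endo_cat)

end


section \<open>Enriched semigroup actions\<close>

text \<open>A one-object category enriched over \<open>C\<close>, with object \<open>s\<close>.  Its hom-object, composition and
  unit are the \<open>T\<close>, \<open>\<mu>\<close> and \<open>\<iota>\<close> of the locale of acting objects.\<close>

locale one_object_enriched_category =
  closed_symmetric_monoidal_category C + enriched_category C \<T>
  for C :: "('o, 'a, 'm) csmcat_scheme" (structure) and \<T> :: "('t, 'o, 'a) ecat" and s :: 't +
  assumes one_object: "EOb \<T> = {s}"
begin

abbreviation "T \<equiv> EHom \<T> s s"
abbreviation "\<mu> \<equiv> EComp \<T> s s s"
abbreviation "\<iota> \<equiv> EId \<T> s"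

sublocale acting_object C T \<mu> \<iota>
  using ehom_Ob[of s s] ecomp_Hom[of s s s] eid_Hom[of s] by unfold_locales (simp_all add: one_object)

lemma self_enriched_select [simp]:
  "EOb (self_enriched C) = Ob C" "EHom (self_enriched C) = IHom C"
  "EComp (self_enriched C) = icomp C" "EId (self_enriched C) = iident C"
  by (simp_all add: self_enriched_def)

lemma parametric_form_enriched_form [simp]: "parametric_form s (enriched_form s p) = p"
  by (cases p) (simp add: parametric_form_def enriched_form_def)

text \<open>The second conjunct says that both components of \<open>F\<close> are extensional.\<close>

lemma enriched_functor_iff:
  "enriched_functor C \<T> (self_enriched C) F \<longleftrightarrow>
    param_endo C T \<mu> \<iota> (parametric_form s F) \<and> enriched_form s (parametric_form s F) = F"
proof -
  have "enriched_form s (parametric_form s F) = F \<longleftrightarrow>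
      EFOb F \<in> extensional {s} \<and> EFHom F \<in> extensional {(s, s)}"
    by (cases F) (auto simp: enriched_form_def parametric_form_def extensional_def fun_eq_iff)
  then show ?thesis
    by (auto simp: enriched_functor_def one_object PiE_iff param_endo_def parametric_form_def)
qed

lemma enriched_nat_trans_iff:
  "enriched_nat_trans C \<T> (self_enriched C) F G \<eta> \<longleftrightarrow>
    (\<lambda>x\<in>{s}. \<eta> s) = \<eta> \<and> \<eta> s \<in> Hom C \<I> (IHom C (EFOb F s) (EFOb G s)) \<and>
    icomp C (EFOb F s) (EFOb G s) (EFOb G s) \<cdot> (EFHom G (s, s) \<boxtimes> \<eta> s) \<cdot> inv_arrow C (Run C T) =
    icomp C (EFOb F s) (EFOb F s) (EFOb G s) \<cdot> (\<eta> s \<boxtimes> EFHom F (s, s)) \<cdot> inv_arrow C (Lun C T)"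
proof -
  have "(\<lambda>x\<in>{s}. \<eta> s) = \<eta> \<longleftrightarrow> \<eta> \<in> extensional {s}"
    by (auto simp: extensional_def fun_eq_iff)
  then show ?thesis
    by (auto simp: enriched_nat_trans_def one_object PiE_iff)
qed

lemma in_Hom_enriched_action_cat:
  "(F, \<eta>, G) \<in> Hom (enriched_action_cat C \<T>) F' G' \<longleftrightarrow>
    F = F' \<and> G = G' \<and> enriched_functor C \<T> (self_enriched C) F \<and>
    enriched_functor C \<T> (self_enriched C) G \<and> enriched_nat_trans C \<T> (self_enriched C) F G \<eta>"
  by (auto simp: enriched_action_cat_def enriched_functor_cat_def Hom_def)

lemma enriched_action_cat_select [simp]:
  "Ob (enriched_action_cat C \<T>) = {F. enriched_functor C \<T> (self_enriched C) F}"
  "\<one>\<^bsub>enriched_action_cat C \<T>\<^esub> F = (F, (\<lambda>x\<in>{s}. iident C (EFOb F s)), F)"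
  "(G, \<theta>, H) \<cdot>\<^bsub>enriched_action_cat C \<T>\<^esub> (F, \<eta>, G') =
    (F, (\<lambda>x\<in>{s}. icomp C (EFOb F s) (EFOb G s) (EFOb H s) \<cdot> (\<theta> s \<boxtimes> \<eta> s) \<cdot> inv_arrow C (Lun C \<I>)), H)"
  "Dom (enriched_action_cat C \<T>) (F, \<eta>, G) = F"
  "Cod (enriched_action_cat C \<T>) (F, \<eta>, G) = G"
  by (auto simp: enriched_action_cat_def enriched_functor_cat_def one_object fun_eq_iff)

lemma FOb_parametric_functor [simp]: "FOb (parametric_functor C s) = parametric_form s"
  by (simp add: parametric_functor_def)

lemma FArr_parametric_functor [simp]:
  "FArr (parametric_functor C s) (F, \<eta>, G) =
    (parametric_form s F, unsharp C (EFOb F s) (EFOb G s) (\<eta> s), parametric_form s G)"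
  by (simp add: parametric_functor_def)

lemma enriched_functor_Ob: "enriched_functor C \<T> (self_enriched C) F \<Longrightarrow> EFOb F s \<in> Ob C"
  by (simp add: enriched_functor_iff param_endo_def parametric_form_def)

text \<open>Arrows of the enriched action category are those of the parameterized endomorphisms,
  presented as global elements of the internal hom.\<close>

lemma in_Hom_enriched_iff:
  "(F, \<eta>, G) \<in> Hom (enriched_action_cat C \<T>) F' G' \<longleftrightarrow>
    F = F' \<and> G = G' \<and> enriched_functor C \<T> (self_enriched C) F \<and>
    enriched_functor C \<T> (self_enriched C) G \<and>
    (\<exists>h. \<eta> = (\<lambda>x\<in>{s}. sharp C (EFOb F s) (EFOb G s) h) \<and>
      (parametric_form s F, h, parametric_form s G)
        \<in> Hom (param_endo_cat C T \<mu> \<iota>) (parametric_form s F) (parametric_form s G))"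
  (is "?l \<longleftrightarrow> ?r")
proof
  assume l: ?l
  then have ob: "EFOb F s \<in> Ob C" "EFOb G s \<in> Ob C"
    by (auto simp: in_Hom_enriched_action_cat enriched_functor_Ob)
  let ?h = "unsharp C (EFOb F s) (EFOb G s) (\<eta> s)"
  have eta: "\<eta> s \<in> Hom C \<I> (IHom C (EFOb F s) (EFOb G s))" "\<eta> = (\<lambda>x\<in>{s}. \<eta> s)"
    using l by (auto simp: in_Hom_enriched_action_cat enriched_nat_trans_iff)
  have "sharp C (EFOb F s) (EFOb G s) ?h = \<eta> s" "?h \<in> Hom C (EFOb F s) (EFOb G s)"
    using sharp_unsharp unsharp_Hom eta(1) ob by auto
  then show ?r
    using l eta(2)
    by (auto simp: in_Hom_enriched_action_cat enriched_nat_trans_iff enriched_functor_iff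
        parametric_form_def in_Hom_param_endo_cat_sharp intro!: exI[of _ ?h])
next
  assume ?r
  then show ?l
    by (auto simp: in_Hom_enriched_action_cat enriched_nat_trans_iff
        parametric_form_def in_Hom_param_endo_cat_sharp sharp_Hom)
qed

lemma in_Hom_param_endo_cat_Hom:
  "(parametric_form s F, h, parametric_form s G) \<in> Hom (param_endo_cat C T \<mu> \<iota>) p q
    \<Longrightarrow> h \<in> Hom C (EFOb F s) (EFOb G s)"
  by (simp add: parametric_form_def in_Hom_param_endo_cat_sharp)

lemma in_Hom_enriched_cases:
  assumes "f \<in> Hom (enriched_action_cat C \<T>) F G"
  obtains h where "f = (F, (\<lambda>x\<in>{s}. sharp C (EFOb F s) (EFOb G s) h), G)"
    "h \<in> Hom C (EFOb F s) (EFOb G s)"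
    "FArr (parametric_functor C s) f = (parametric_form s F, h, parametric_form s G)"
    "(parametric_form s F, h, parametric_form s G)
        \<in> Hom (param_endo_cat C T \<mu> \<iota>) (parametric_form s F) (parametric_form s G)"
    "enriched_functor C \<T> (self_enriched C) F" "enriched_functor C \<T> (self_enriched C) G"
  using assms
  by (cases f) (auto simp: in_Hom_enriched_iff unsharp_sharp dest: in_Hom_param_endo_cat_Hom)

lemma cat_functor_parametric:
  "cat_functor (enriched_action_cat C \<T>) (param_endo_cat C T \<mu> \<iota>) (parametric_functor C s)"
  (is "cat_functor ?E ?P ?F")
proof (rule faithful_functorI)
  show P: "category ?P" using cat_functor_adjoint_action by (simp add: cat_functor_def)
  interpret P: category ?P by (rule P)
  show "Dom ?E f \<in> Ob ?E \<and> Cod ?E f \<in> Ob ?E" if "f \<in> Arr ?E" for f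
    using that by (auto simp: enriched_action_cat_def enriched_functor_cat_def)
  show "FOb ?F X \<in> Ob ?P" if "X \<in> Ob ?E" for X
    using that by (simp add: enriched_functor_iff)
  show "FArr ?F f \<in> Hom ?P (FOb ?F X) (FOb ?F Y)" if "f \<in> Hom ?E X Y" for f X Y
    by (rule in_Hom_enriched_cases[OF that]) simp
  show "f = g" if "f \<in> Hom ?E X Y" "g \<in> Hom ?E X Y" "FArr ?F f = FArr ?F g" for f g X Y
    by (rule in_Hom_enriched_cases[OF that(1)], rule in_Hom_enriched_cases[OF that(2)])
      (use that(3) in simp)
  show "\<one>\<^bsub>?E\<^esub> X \<in> Hom ?E X X \<and> FArr ?F (\<one>\<^bsub>?E\<^esub> X) = \<one>\<^bsub>?P\<^esub> (FOb ?F X)" if "X \<in> Ob ?E" for X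
    using that P.id_Hom[of "parametric_form s X"] enriched_functor_Ob[of X]
    by (auto simp: in_Hom_enriched_iff enriched_functor_iff unsharp_iident iident_def
        unsharp_sharp id_Hom parametric_form_def)
  show "g \<cdot>\<^bsub>?E\<^esub> f \<in> Hom ?E X Z \<and> FArr ?F (g \<cdot>\<^bsub>?E\<^esub> f) = FArr ?F g \<cdot>\<^bsub>?P\<^esub> FArr ?F f"
    if fg: "f \<in> Hom ?E X Y" "g \<in> Hom ?E Y Z" for f g X Y Z
  proof (rule in_Hom_enriched_cases[OF fg(1)], rule in_Hom_enriched_cases[OF fg(2)])
    fix h k
    assume f: "f = (X, (\<lambda>x\<in>{s}. sharp C (EFOb X s) (EFOb Y s) h), Y)"
        "h \<in> Hom C (EFOb X s) (EFOb Y s)"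
        "FArr ?F f = (parametric_form s X, h, parametric_form s Y)"
        "(parametric_form s X, h, parametric_form s Y) \<in> Hom ?P (parametric_form s X) (parametric_form s Y)"
      and g: "g = (Y, (\<lambda>x\<in>{s}. sharp C (EFOb Y s) (EFOb Z s) k), Z)"
        "k \<in> Hom C (EFOb Y s) (EFOb Z s)"
        "FArr ?F g = (parametric_form s Y, k, parametric_form s Z)"
        "(parametric_form s Y, k, parametric_form s Z) \<in> Hom ?P (parametric_form s Y) (parametric_form s Z)"
      and XZ: "enriched_functor C \<T> (self_enriched C) X" "enriched_functor C \<T> (self_enriched C) Z"
    have gf: "g \<cdot>\<^bsub>?E\<^esub> f = (X, (\<lambda>x\<in>{s}. sharp C (EFOb X s) (EFOb Z s) (k \<cdot> h)), Z)"
      by (simp add: f(1) g(1) sharp_comp[OF f(2) g(2)])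
    have "FArr ?F (g \<cdot>\<^bsub>?E\<^esub> f) = (parametric_form s X, k \<cdot> h, parametric_form s Z)"
      using comp_Hom[OF f(2) g(2)] by (simp add: gf unsharp_sharp)
    moreover have "(parametric_form s X, k \<cdot> h, parametric_form s Z)
        \<in> Hom ?P (parametric_form s X) (parametric_form s Z)"
      using P.comp_Hom[OF f(4) g(4)] by simp
    ultimately show ?thesis
      using XZ unfolding f(3) g(3) by (auto simp: gf in_Hom_enriched_iff)
  qed
qed

lemma inverse_functors_parametric:
  "inverse_functors (enriched_action_cat C \<T>) (param_endo_cat C T \<mu> \<iota>)
    (parametric_functor C s) (enriched_form_functor C s)"
  (is "inverse_functors ?E ?P ?F ?G")
proof (rule inverse_functorsI[OF cat_functor_parametric])
  show "FOb ?G p \<in> Ob ?E \<and> FOb ?F (FOb ?G p) = p" if "p \<in> Ob ?P" for p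
    using that by (simp add: enriched_form_functor_def enriched_functor_iff)
  show "FOb ?G (FOb ?F X) = X" if "X \<in> Ob ?E" for X
    using that by (simp add: enriched_form_functor_def enriched_functor_iff)
  have EFOb: "EFOb (enriched_form s p) s = fst p" for p
    by (cases p) (simp add: enriched_form_def)
  show "FArr ?G f \<in> Hom ?E (FOb ?G p) (FOb ?G q) \<and> FArr ?F (FArr ?G f) = f" if "f \<in> Hom ?P p q" for f p q
  proof -
    obtain p' h q' where "f = (p', h, q')" by (rule prod_cases3)
    with that have f: "f = (p, h, q)" by (simp add: in_Hom_param_endo_cat)
    then have "h \<in> Hom C (fst p) (fst q)"
      using that by (auto simp: in_Hom_param_endo_cat in_Hom_left_action_cat)
    then show ?thesis
      using that f by (auto simp: enriched_form_functor_def in_Hom_enriched_iff EFOb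
        in_Hom_param_endo_cat enriched_functor_iff unsharp_sharp)
  qed
  show "FArr ?G (FArr ?F f) = f" if "f \<in> Arr ?E" for f
  proof -
    have "f \<in> Hom ?E (Dom ?E f) (Cod ?E f)" using that by (simp add: Hom_def)
    then show ?thesis
      by (rule in_Hom_enriched_cases)
        (simp add: enriched_form_functor_def enriched_functor_iff, simp add: parametric_form_def)
  qed
qed

lemma enriched_to_left_action_functor_eq:
  "comp_functor (adjoint_action_functor C T) (parametric_functor C s) =
    enriched_to_left_action_functor C s T"
  by (auto simp: comp_functor_def adjoint_action_functor_def parametric_functor_def
      enriched_to_left_action_functor_def fun_eq_iff adjoint_action_def parametric_form_def
      enriched_to_left_action_def)

end


section \<open>The three isomorphic categories\<close>

theorem theorem2:
  fixes C :: "('o, 'a) csmcat"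
    and \<T> :: "('t, 'o, 'a) ecat"
    and s :: 't
    and T :: 'o
    and \<mu> \<iota> :: 'a
  assumes "closed_symmetric_monoidal_category C"
    and "enriched_category C \<T>"
    and "EOb \<T> = {s}"
    and "T = EHom \<T> s s"
    and "\<mu> = EComp \<T> s s s"
    and "\<iota> = EId \<T> s"
  shows
    \<comment> \<open>(i)\<close>
    "(category (enriched_action_cat C \<T>) \<and> category (left_action_cat C T \<mu> \<iota>)) \<and>
    \<comment> \<open>(ii)\<close>
     cat_isomorphism (enriched_action_cat C \<T>) (left_action_cat C T \<mu> \<iota>)
       (enriched_to_left_action_functor C s T) \<and>
    \<comment> \<open>(iii)\<close>
     (bij_betw (parametric_form s) (Ob (enriched_action_cat C \<T>)) (Ob (param_endo_cat C T \<mu> \<iota>)) \<and>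
      bij_betw (adjoint_action C T) (Ob (param_endo_cat C T \<mu> \<iota>)) (Ob (left_action_cat C T \<mu> \<iota>))) \<and>
    \<comment> \<open>(iv)\<close>
     (category (param_endo_cat C T \<mu> \<iota>) \<and>
      cat_isomorphism (enriched_action_cat C \<T>) (param_endo_cat C T \<mu> \<iota>)
        (parametric_functor C s) \<and>
      cat_isomorphism (param_endo_cat C T \<mu> \<iota>) (left_action_cat C T \<mu> \<iota>)
        (adjoint_action_functor C T) \<and>
      functor_eq_on (enriched_action_cat C \<T>)
        (comp_functor (adjoint_action_functor C T) (parametric_functor C s))
        (enriched_to_left_action_functor C s T)) \<and>
    \<comment> \<open>(v)\<close>
     (inverse_functors (enriched_action_cat C \<T>) (param_endo_cat C T \<mu> \<iota>)
        (parametric_functor C s) (enriched_form_functor C s) \<and>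
      inverse_functors (param_endo_cat C T \<mu> \<iota>) (left_action_cat C T \<mu> \<iota>)
        (adjoint_action_functor C T) (adjoint_endo_functor C T))"
proof -
  interpret closed_symmetric_monoidal_category C by (rule assms(1))
  interpret enriched_category C \<T> by (rule assms(2))
  interpret one_object_enriched_category C \<T> s by unfold_locales (rule assms(3))
  let ?E = "enriched_action_cat C \<T>" and ?P = "param_endo_cat C T \<mu> \<iota>"
    and ?L = "left_action_cat C T \<mu> \<iota>"
  have EP: "inverse_functors ?E ?P (parametric_functor C s) (enriched_form_functor C s)"
    and PL: "inverse_functors ?P ?L (adjoint_action_functor C T) (adjoint_endo_functor C T)"
    and eq: "comp_functor (adjoint_action_functor C T) (parametric_functor C s) =
      enriched_to_left_action_functor C s T"
    unfolding assms(4-6)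
    by (rule inverse_functors_parametric inverse_functors_adjoint enriched_to_left_action_functor_eq)+
  have EL: "cat_isomorphism ?E ?L (enriched_to_left_action_functor C s T)"
    using inverse_functors_comp[OF EP PL] unfolding eq cat_isomorphism_def by blast
  have "category ?E" "category ?P" "category ?L"
    using EP PL by (auto simp: inverse_functors_def cat_functor_def)
  moreover have "bij_betw (parametric_form s) (Ob ?E) (Ob ?P)"
    "bij_betw (adjoint_action C T) (Ob ?P) (Ob ?L)"
    using inverse_functors_bij_betw[OF EP] inverse_functors_bij_betw[OF PL]
    by (simp_all add: parametric_functor_def adjoint_action_functor_def)
  ultimately show ?thesis
    using EP PL EL eq by (auto simp: cat_isomorphism_def functor_eq_on_def)
qed

end
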